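(* Let $N,M$ be positive integers with $N,M>1$. Let $\Gamma_{[N]}$ and $\Gamma_{[M]}$ be the continuous full groups of the one-sided full $N$-shift and of the one-sided full $M$-shift respectively. Then $\Gamma_{[N]}$ and $\Gamma_{[M]}$ are isomorphic as abstract groups if and only if $N=M$.
   Context: The one-sided full $N$-shift is the space $X=\{1,\dots,N\}^{\mathbb{N}}$ with the product topology together with the shift $\sigma((x_n)_n)=(x_{n+1})_n$. Its continuous full group $\Gamma_{[N]}$ is the group of all homeomorphisms $\tau$ of $X$ for which there exist continuous functions $k,l:X\to\mathbb{Z}_{+}=\{0,1,2,\dots\}$ with $\sigma^{k(x)}(\tau(x))=\sigma^{l(x)}(x)$ for all $x\in X$. *)

theory Defs
  imports "HOL-Analysis.Analysis" "HOL-Algebra.Bij"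
begin

definition full_shift_space :: "nat \<Rightarrow> (nat \<Rightarrow> nat) topology" where
  "full_shift_space N = product_topology (\<lambda>_. discrete_topology {1..N}) UNIV"

definition shift :: "(nat \<Rightarrow> nat) \<Rightarrow> (nat \<Rightarrow> nat)" where
  "shift x = (\<lambda>n. x (Suc n))"

text \<open>
  A self-map of the shift space is represented by an extensional function on the ambient type,
  so that equality of elements is equality of maps on the space itself.
\<close>

definition continuous_full_group_carrier :: "nat \<Rightarrow> ((nat \<Rightarrow> nat) \<Rightarrow> (nat \<Rightarrow> nat)) set" where
  "continuous_full_group_carrier N =
    {\<tau> \<in> extensional (topspace (full_shift_space N)).
       homeomorphic_map (full_shift_space N) (full_shift_space N) \<tau> \<and>
       (\<exists>k l :: (nat \<Rightarrow> nat) \<Rightarrow> nat.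
          continuous_map (full_shift_space N) (discrete_topology UNIV) k \<and>
          continuous_map (full_shift_space N) (discrete_topology UNIV) l \<and>
          (\<forall>x \<in> topspace (full_shift_space N).
             (shift ^^ k x) (\<tau> x) = (shift ^^ l x) x))}"

definition continuous_full_group :: "nat \<Rightarrow> ((nat \<Rightarrow> nat) \<Rightarrow> (nat \<Rightarrow> nat)) monoid" where
  "continuous_full_group N =
    BijGroup (topspace (full_shift_space N)) \<lparr>carrier := continuous_full_group_carrier N\<rparr>"

lemma topspace_full_shift_space:
  "topspace (full_shift_space N) = {x. \<forall>n. x n \<in> {1..N}}"
  by (auto simp: full_shift_space_def)

lemma continuous_map_discrete_add:
  fixes f g :: "'a \<Rightarrow> nat"
  assumes "continuous_map X (discrete_topology UNIV) f"
    and "continuous_map X (discrete_topology UNIV) g"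
  shows "continuous_map X (discrete_topology UNIV) (\<lambda>x. f x + g x)"
proof -
  have op: "openin X {x \<in> topspace X. f x \<in> V}" "openin X {x \<in> topspace X. g x \<in> V}" for V
    using assms by (simp_all add: continuous_map_def)
  have "openin X {x \<in> topspace X. f x + g x \<in> U}" for U
  proof -
    have "{x \<in> topspace X. f x + g x \<in> U} =
        (\<Union>m. {x \<in> topspace X. f x \<in> {m}} \<inter> {x \<in> topspace X. g x \<in> {n. m + n \<in> U}})"
      by auto
    moreover have "openin X \<dots>"
      by (rule openin_Union) (use op openin_Int in blast)
    ultimately show ?thesis
      by simp
  qed
  then show ?thesis
    by (simp add: continuous_map_def)
qed

lemma continuous_full_group_carrier_compose:
  assumes S: "\<sigma> \<in> continuous_full_group_carrier N"
    and T: "\<tau> \<in> continuous_full_group_carrier N"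
  shows "compose (topspace (full_shift_space N)) \<sigma> \<tau> \<in> continuous_full_group_carrier N"
proof -
  let ?X = "full_shift_space N"
  obtain k l where kl:
    "continuous_map ?X (discrete_topology UNIV) k" "continuous_map ?X (discrete_topology UNIV) l"
    "\<And>x. x \<in> topspace ?X \<Longrightarrow> (shift ^^ k x) (\<sigma> x) = (shift ^^ l x) x"
    using S by (auto simp: continuous_full_group_carrier_def)
  obtain k' l' where kl':
    "continuous_map ?X (discrete_topology UNIV) k'" "continuous_map ?X (discrete_topology UNIV) l'"
    "\<And>x. x \<in> topspace ?X \<Longrightarrow> (shift ^^ k' x) (\<tau> x) = (shift ^^ l' x) x"
    using T by (auto simp: continuous_full_group_carrier_def)
  have hs: "homeomorphic_map ?X ?X \<sigma>" and ht: "homeomorphic_map ?X ?X \<tau>"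
    using S T by (auto simp: continuous_full_group_carrier_def)
  have ct: "continuous_map ?X ?X \<tau>"
    using ht homeomorphic_imp_continuous_map by blast
  have tX: "\<tau> x \<in> topspace ?X" if "x \<in> topspace ?X" for x
    using ht that homeomorphic_imp_surjective_map by blast
  have "homeomorphic_map ?X ?X (compose (topspace ?X) \<sigma> \<tau>)"
    by (rule homeomorphic_map_eq [OF homeomorphic_map_compose [OF ht hs]]) (simp add: compose_def)
  moreover have "continuous_map ?X (discrete_topology UNIV) (\<lambda>x. k' x + k (\<tau> x))"
    using continuous_map_discrete_add [OF kl'(1) continuous_map_compose [OF ct kl(1)]] by simp
  moreover have "continuous_map ?X (discrete_topology UNIV) (\<lambda>x. l (\<tau> x) + l' x)"
    using continuous_map_discrete_add [OF continuous_map_compose [OF ct kl(2)] kl'(2)] by simp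
  moreover have "(shift ^^ (k' x + k (\<tau> x))) (compose (topspace ?X) \<sigma> \<tau> x)
                   = (shift ^^ (l (\<tau> x) + l' x)) x" if x: "x \<in> topspace ?X" for x
  proof -
    have "(shift ^^ (k' x + k (\<tau> x))) (\<sigma> (\<tau> x)) = (shift ^^ k' x) ((shift ^^ l (\<tau> x)) (\<tau> x))"
      using kl(3) [OF tX [OF x]] by (simp add: funpow_add)
    also have "\<dots> = (shift ^^ l (\<tau> x)) ((shift ^^ k' x) (\<tau> x))"
      by (metis add.commute comp_apply funpow_add)
    also have "\<dots> = (shift ^^ (l (\<tau> x) + l' x)) x"
      using kl'(3) [OF x] by (simp add: funpow_add)
    finally show ?thesis
      using x by (simp add: compose_def)
  qed
  ultimately show ?thesis
    unfolding continuous_full_group_carrier_def by (blast intro: compose_extensional)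
qed

lemma continuous_full_group_carrier_inverse:
  assumes T: "\<tau> \<in> continuous_full_group_carrier N"
  shows "restrict (inv_into (topspace (full_shift_space N)) \<tau>) (topspace (full_shift_space N))
           \<in> continuous_full_group_carrier N"
proof -
  let ?X = "full_shift_space N"
  let ?i = "restrict (inv_into (topspace ?X) \<tau>) (topspace ?X)"
  obtain k l where kl:
    "continuous_map ?X (discrete_topology UNIV) k" "continuous_map ?X (discrete_topology UNIV) l"
    "\<And>x. x \<in> topspace ?X \<Longrightarrow> (shift ^^ k x) (\<tau> x) = (shift ^^ l x) x"
    using T by (auto simp: continuous_full_group_carrier_def)
  have ht: "homeomorphic_map ?X ?X \<tau>"
    using T by (auto simp: continuous_full_group_carrier_def)
  then obtain g where g: "homeomorphic_maps ?X ?X \<tau> g"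
    using homeomorphic_map_maps by blast
  have inj: "inj_on \<tau> (topspace ?X)" and surj: "\<tau> ` topspace ?X = topspace ?X"
    using ht homeomorphic_imp_injective_map homeomorphic_imp_surjective_map by blast+
  have gi: "g x = ?i x" if "x \<in> topspace ?X" for x
  proof -
    have "g x \<in> topspace ?X" "\<tau> (g x) = x"
      using g that by (auto simp: homeomorphic_maps_def continuous_map_def)
    then show ?thesis
      using that inj by (simp add: inv_into_f_eq)
  qed
  have hi: "homeomorphic_map ?X ?X ?i"
    using g gi homeomorphic_map_eq homeomorphic_maps_map by blast
  then have ci: "continuous_map ?X ?X ?i"
    using homeomorphic_imp_continuous_map by blast
  have "continuous_map ?X (discrete_topology UNIV) (k \<circ> ?i)"
    "continuous_map ?X (discrete_topology UNIV) (l \<circ> ?i)"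
    using continuous_map_compose ci kl by blast+
  moreover have "(shift ^^ (l \<circ> ?i) x) (?i x) = (shift ^^ (k \<circ> ?i) x) x"
    if x: "x \<in> topspace ?X" for x
  proof -
    have "?i x \<in> topspace ?X" "\<tau> (?i x) = x"
      using x surj by (auto simp: inv_into_into f_inv_into_f)
    then show ?thesis
      using kl(3) [of "?i x"] by simp
  qed
  ultimately show ?thesis
    unfolding continuous_full_group_carrier_def using hi by blast
qed

lemma subgroup_continuous_full_group_carrier:
  "subgroup (continuous_full_group_carrier N) (BijGroup (topspace (full_shift_space N)))"
proof -
  let ?X = "full_shift_space N"
  have sub: "continuous_full_group_carrier N \<subseteq> Bij (topspace ?X)"
    unfolding continuous_full_group_carrier_def Bij_def bij_betw_def
    using homeomorphic_imp_injective_map homeomorphic_imp_surjective_map by blast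
  have "homeomorphic_map ?X ?X (restrict id (topspace ?X))"
    by (rule homeomorphic_map_eq [of _ _ id]) auto
  then have one: "(\<lambda>x \<in> topspace ?X. x) \<in> continuous_full_group_carrier N"
    unfolding continuous_full_group_carrier_def
    by (simp add: id_def) (rule exI [of _ "\<lambda>_. 0"], simp, rule exI [of _ "\<lambda>_. 0"], simp)
  show ?thesis
  proof (rule subgroup.intro)
    show "continuous_full_group_carrier N \<subseteq> carrier (BijGroup (topspace ?X))"
      using sub by (simp add: BijGroup_def)
  next
    fix \<sigma> \<tau> assume "\<sigma> \<in> continuous_full_group_carrier N" "\<tau> \<in> continuous_full_group_carrier N"
    moreover from this have "\<sigma> \<in> Bij (topspace ?X)" "\<tau> \<in> Bij (topspace ?X)"
      using sub by auto
    ultimately show "\<sigma> \<otimes>\<^bsub>BijGroup (topspace ?X)\<^esub> \<tau> \<in> continuous_full_group_carrier N"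
      by (simp add: BijGroup_def continuous_full_group_carrier_compose)
  next
    show "\<one>\<^bsub>BijGroup (topspace ?X)\<^esub> \<in> continuous_full_group_carrier N"
      using one by (simp add: BijGroup_def)
  next
    fix \<tau> assume "\<tau> \<in> continuous_full_group_carrier N"
    moreover from this have "\<tau> \<in> Bij (topspace ?X)"
      using sub by auto
    ultimately show "inv\<^bsub>BijGroup (topspace ?X)\<^esub> \<tau> \<in> continuous_full_group_carrier N"
      by (simp add: inv_BijGroup continuous_full_group_carrier_inverse)
  qed
qed

theorem group_continuous_full_group: "group (continuous_full_group N)"
  unfolding continuous_full_group_def
  by (rule subgroup.subgroup_is_group [OF subgroup_continuous_full_group_carrier group_BijGroup])

end

theory Submission
  imports Defs "HOL-Number_Theory.Number_Theory"
begin

text \<open>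
  For a prime \<open>p\<close> coprime to \<open>N - 1\<close>, the group of the full \<open>N\<close>-shift has exactly \<open>N\<close> conjugacy
  classes of elements of order \<open>p\<close>; taking \<open>p > N + M\<close> recovers \<open>N\<close> from the abstract group.

  Elements of the group act locally by replacing a prefix. The number of cylinders in a partition of a
  clopen set \<open>A\<close> is well defined modulo \<open>N - 1\<close>, because splitting a cylinder replaces one by
  \<open>N\<close>, and it is invariant under the group; conversely two nonempty clopen sets with the same count
  are related by a locally prefix replacing bijection. If \<open>\<tau>\<close> has prime order \<open>p\<close>, its fixed
  point set \<open>F\<close> is clopen and the complement of \<open>F\<close> is the disjoint union of
  \<open>A, \<tau>(A), \<dots>, \<tau>\<^sup>p\<^sup>-\<^sup>1(A)\<close> for some clopen \<open>A\<close>. As the whole space is one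
  cylinder, the counts satisfy \<open>p |A| + |F| = 1\<close> modulo \<open>N - 1\<close>, so \<open>|F|\<close> determines
  \<open>|A|\<close>, and \<open>\<tau>\<close> is classified up to conjugacy by \<open>|F|\<close> together with whether \<open>F\<close> is
  empty. The \<open>N - 1\<close> residues with \<open>F\<close> nonempty and the single case of empty \<open>F\<close> all occur.
\<close>

section \<open>Words and sequences\<close>

definition conc :: "nat list \<Rightarrow> (nat \<Rightarrow> nat) \<Rightarrow> (nat \<Rightarrow> nat)" (infixr \<open>\<frown>\<close> 65)
  where "w \<frown> x = (\<lambda>n. if n < length w then w ! n else x (n - length w))"

definition pref :: "nat \<Rightarrow> (nat \<Rightarrow> nat) \<Rightarrow> nat list"
  where "pref n x = map x [0..<n]"

lemma length_pref [simp]: "length (pref n x) = n"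
  by (simp add: pref_def)

lemma pref_eq_iff: "pref n x = pref n y \<longleftrightarrow> (\<forall>i<n. x i = y i)"
  by (auto simp: pref_def)

lemma conc_Nil [simp]: "[] \<frown> x = x"
  by (simp add: conc_def)

lemma append_conc [simp]: "(u @ v) \<frown> x = u \<frown> v \<frown> x"
  by (auto simp: conc_def nth_append fun_eq_iff)

lemma shift_funpow: "(shift ^^ n) x = (\<lambda>i. x (i + n))"
  by (induction n) (auto simp: shift_def)

lemma shift_funpow_conc: "(shift ^^ (length w)) (w \<frown> x) = x"
  by (auto simp: shift_funpow conc_def)

lemma pref_conc_shift: "pref n x \<frown> (shift ^^ n) x = x"
  by (auto simp: conc_def pref_def shift_funpow fun_eq_iff)

lemma pref_conc: "length w \<le> n \<Longrightarrow> pref n (w \<frown> x) = w @ pref (n - length w) x"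
  by (rule nth_equalityI) (auto simp: pref_def conc_def nth_append)

lemma pref_conc_length [simp]: "pref (length w) (w \<frown> x) = w"
  by (subst pref_conc) (auto simp: pref_def)

lemma conc_eq_iff: "length u = length v \<Longrightarrow> u \<frown> x = v \<frown> y \<longleftrightarrow> u = v \<and> x = y"
  by (metis pref_conc_length shift_funpow_conc)

lemma conc_cancel [simp]: "u \<frown> x = u \<frown> y \<longleftrightarrow> x = y"
  by (simp add: conc_eq_iff)

text \<open>Two prefixes of one sequence are comparable, and the excess \<open>w\<close> of the
  longer one is the beginning of the tail left by the shorter one. This aligns prefix replacements
  before they are composed or iterated.\<close>

lemma conc_eq_conc_decomp:
  assumes "u \<frown> x = v \<frown> y" "length u \<le> length v"
  obtains w where "v = u @ w" "x = w \<frown> y"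
proof -
  have "v = u @ pref (length v - length u) x"
    using assms by (metis pref_conc pref_conc_length)
  moreover from this have "u \<frown> x = u \<frown> (pref (length v - length u) x \<frown> y)"
    using assms(1) by (metis append_conc)
  ultimately show thesis
    using that conc_cancel by blast
qed

section \<open>Cylinders and the topology of the shift space\<close>

locale full_shift =
  fixes N :: nat
  assumes N_gt_1: "N > 1"
begin

abbreviation T :: "(nat \<Rightarrow> nat) topology" where "T \<equiv> full_shift_space N"
abbreviation X :: "(nat \<Rightarrow> nat) set" where "X \<equiv> topspace (full_shift_space N)"

definition words :: "nat list set" where "words = lists {1..N}"

lemma Nil_in_words [simp]: "[] \<in> words"
  and append_in_words [simp]: "u @ v \<in> words \<longleftrightarrow> u \<in> words \<and> v \<in> words"
  and singleton_in_words [simp]: "[a] \<in> words \<longleftrightarrow> a \<in> {1..N}"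
  by (auto simp: words_def)

lemma words_iff_nth: "w \<in> words \<longleftrightarrow> (\<forall>i<length w. w ! i \<in> {1..N})"
  by (simp add: words_def in_lists_conv_set all_set_conv_all_nth)

definition cyl :: "nat list \<Rightarrow> (nat \<Rightarrow> nat) set" where "cyl w = (\<frown>) w ` X"

lemma conc_in_X [simp]: "w \<frown> x \<in> X \<longleftrightarrow> w \<in> words \<and> x \<in> X"
proof
  assume *: "w \<frown> x \<in> X"
  have "w ! n \<in> {1..N}" if "n < length w" for n
    using * that by (force simp: topspace_full_shift_space conc_def dest: spec[of _ n])
  moreover have "x n \<in> {1..N}" for n
    using * by (force simp: topspace_full_shift_space conc_def dest: spec[of _ "n + length w"])
  ultimately show "w \<in> words \<and> x \<in> X"
    by (auto simp: topspace_full_shift_space words_iff_nth)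
next
  assume *: "w \<in> words \<and> x \<in> X"
  then have "w ! n \<in> {1..N}" if "n < length w" for n
    using that by (simp add: words_iff_nth del: atLeastAtMost_iff)
  then show "w \<frown> x \<in> X"
    using * by (auto simp: topspace_full_shift_space conc_def)
qed

lemma pref_in_words [simp]: "x \<in> X \<Longrightarrow> pref n x \<in> words"
  and shift_funpow_in_X [simp]: "x \<in> X \<Longrightarrow> (shift ^^ n) x \<in> X"
  using conc_in_X[of "pref n x" "(shift ^^ n) x"] by (simp_all add: pref_conc_shift)

lemma const_in_X: "a \<in> {1..N} \<Longrightarrow> (\<lambda>_. a) \<in> X"
  by (simp add: topspace_full_shift_space)

lemma X_nonempty: "X \<noteq> {}"
  using const_in_X[of 1] N_gt_1 by auto

lemma cyl_subset_X: "w \<in> words \<Longrightarrow> cyl w \<subseteq> X"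
  by (auto simp: cyl_def)

lemma cyl_nonempty: "cyl w \<noteq> {}"
  using X_nonempty by (auto simp: cyl_def)

lemma conc_in_cyl [simp]: "x \<in> X \<Longrightarrow> w \<frown> x \<in> cyl w"
  by (simp add: cyl_def)

lemma in_cyl_iff: "w \<in> words \<Longrightarrow> x \<in> cyl w \<longleftrightarrow> x \<in> X \<and> pref (length w) x = w"
  unfolding cyl_def using pref_conc_shift[of "length w" x] shift_funpow_in_X[of x "length w"]
  by (auto simp: image_iff simp del: shift_funpow_in_X) metis

lemma in_cyl_pref [simp]: "x \<in> X \<Longrightarrow> x \<in> cyl (pref n x)"
  by (simp add: in_cyl_iff)

lemma in_cyl_pref_iff: "x \<in> X \<Longrightarrow> y \<in> cyl (pref n x) \<longleftrightarrow> y \<in> X \<and> (\<forall>i<n. y i = x i)"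
  by (simp add: in_cyl_iff pref_eq_iff)

lemma cyl_append_subset: "v \<in> words \<Longrightarrow> cyl (u @ v) \<subseteq> cyl u"
  by (auto simp: cyl_def)

lemma cyl_pref_mono: "x \<in> X \<Longrightarrow> m \<le> n \<Longrightarrow> cyl (pref n x) \<subseteq> cyl (pref m x)"
  by (auto simp: in_cyl_pref_iff)

text \<open>A basic open set of the product topology constrains only finitely many letters, hence
  only letters below some depth. From here on topology is expressed by prefixes alone.\<close>

lemma openin_iff_cyl: "openin T A \<longleftrightarrow> A \<subseteq> X \<and> (\<forall>x\<in>A. \<exists>n. cyl (pref n x) \<subseteq> A)"
proof (intro iffI conjI ballI)
  assume A: "openin T A"
  show AX: "A \<subseteq> X"
    using A by (rule openin_subset)
  fix x assume x: "x \<in> A"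
  obtain U where U: "finite {i. U i \<noteq> {1..N}}" "x \<in> Pi\<^sub>E UNIV U" "Pi\<^sub>E UNIV U \<subseteq> A"
    using A x unfolding full_shift_space_def openin_product_topology_alt
    by (auto dest!: bspec[OF _ x])
  obtain n where n: "\<And>i. U i \<noteq> {1..N} \<Longrightarrow> i < n"
    using U(1) unfolding finite_nat_set_iff_bounded by auto
  have "cyl (pref n x) \<subseteq> Pi\<^sub>E UNIV U"
  proof
    fix y assume y: "y \<in> cyl (pref n x)"
    have "y i \<in> U i" for i
    proof (cases "i < n")
      case True
      then show ?thesis
        using y U(2) in_cyl_pref_iff[of x y n] AX x by (auto simp: PiE_iff)
    next
      case False
      then have "U i = {1..N}"
        using n by blast
      then show ?thesis
        using y in_cyl_pref_iff[of x y n] AX x by (auto simp: topspace_full_shift_space)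
    qed
    then show "y \<in> Pi\<^sub>E UNIV U"
      by auto
  qed
  then show "\<exists>n. cyl (pref n x) \<subseteq> A"
    using U(3) by blast
next
  assume A: "A \<subseteq> X \<and> (\<forall>x\<in>A. \<exists>n. cyl (pref n x) \<subseteq> A)"
  show "openin T A"
    unfolding full_shift_space_def openin_product_topology_alt
  proof
    fix x assume x: "x \<in> A"
    then obtain n where n: "cyl (pref n x) \<subseteq> A"
      using A by blast
    \<comment> \<open>This box is exactly the cylinder of \<open>pref n x\<close>: the first
      \<open>n\<close> letters are pinned and the others are free.\<close>
    define U where "U = (\<lambda>i. if i < n then {x i} else {1..N})"
    have xX: "x \<in> X"
      using x A by blast
    have "{i. U i \<noteq> {1..N}} \<subseteq> {..<n}"
      by (auto simp: U_def)
    then have "finite {i. U i \<noteq> {1..N}}"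
      using finite_subset by blast
    moreover have "openin (discrete_topology {1..N}) (U i)" for i
      using xX by (auto simp: U_def topspace_full_shift_space)
    moreover have "x \<in> Pi\<^sub>E UNIV U"
      using xX by (auto simp: U_def topspace_full_shift_space)
    moreover have "Pi\<^sub>E UNIV U \<subseteq> A"
    proof
      fix y assume y: "y \<in> Pi\<^sub>E UNIV U"
      have yi: "y i \<in> U i" for i
        using y by auto
      have "y i \<in> {1..N}" for i
        using yi[of i] xX by (auto simp: U_def topspace_full_shift_space split: if_splits)
      moreover have "y i = x i" if "i < n" for i
        using yi[of i] that by (simp add: U_def)
      ultimately have "y \<in> cyl (pref n x)"
        using in_cyl_pref_iff[OF xX] by (auto simp: topspace_full_shift_space)
      then show "y \<in> A"
        using n by blast
    qed
    ultimately show "\<exists>U. finite {i \<in> UNIV. U i \<noteq> topspace (discrete_topology {1..N})} \<and>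
            (\<forall>i\<in>UNIV. openin (discrete_topology {1..N}) (U i)) \<and>
            x \<in> Pi\<^sub>E UNIV U \<and> Pi\<^sub>E UNIV U \<subseteq> A"
      by (intro exI[of _ U]) simp
  qed
qed

lemma openin_cyl: 
  assumes "w \<in> words"
  shows "openin T (cyl w)"
  unfolding openin_iff_cyl
proof (intro conjI ballI exI)
  show "cyl w \<subseteq> X"
    using assms by (rule cyl_subset_X)
  show "cyl (pref (length w) x) \<subseteq> cyl w" if "x \<in> cyl w" for x
    using that in_cyl_iff[OF assms] by auto
qed

lemma compact_space_T: "compact_space T"
  by (simp add: full_shift_space_def compact_space_product_topology compact_space_discrete_topology)

lemma Hausdorff_space_T: "Hausdorff_space T"
  by (simp add: full_shift_space_def Hausdorff_space_product_topology Hausdorff_space_discrete_topology)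


definition clopen :: "(nat \<Rightarrow> nat) set \<Rightarrow> bool" where "clopen A \<longleftrightarrow> openin T A \<and> closedin T A"

lemma clopen_subset_X: "clopen A \<Longrightarrow> A \<subseteq> X"
  by (simp add: clopen_def openin_subset)

lemma clopen_X: "clopen X"
  by (simp add: clopen_def)

lemma clopen_Diff: "clopen A \<Longrightarrow> clopen B \<Longrightarrow> clopen (A - B)"
  by (simp add: clopen_def openin_diff closedin_diff)

section \<open>Partitions into cylinders\<close>

definition cylinder_partition :: "nat list set \<Rightarrow> (nat \<Rightarrow> nat) set \<Rightarrow> bool"
  where "cylinder_partition S A \<longleftrightarrow>
    finite S \<and> S \<subseteq> words \<and> disjoint_family_on cyl S \<and> A = \<Union> (cyl ` S)"

text \<open>By compactness finitely many cylinders inside \<open>A\<close> with property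
  \<open>Q\<close> cover \<open>A\<close>. Since \<open>Q\<close> passes to longer words, all of
  them can be refined to one common length \<open>L\<close>, and distinct words of equal length have
  disjoint cylinders.\<close>

lemma clopen_refined_partition:
  assumes A: "clopen A"
    and Q: "\<And>x. x \<in> A \<Longrightarrow> \<exists>n. Q (pref n x)"
    and Q_append: "\<And>u v. Q u \<Longrightarrow> v \<in> words \<Longrightarrow> Q (u @ v)"
  obtains S where "cylinder_partition S A" "\<And>w. w \<in> S \<Longrightarrow> Q w"
proof -
  have AX: "A \<subseteq> X"
    using A by (rule clopen_subset_X)
  define D where "D = {w \<in> words. Q w \<and> cyl w \<subseteq> A}"
  have cover: "A \<subseteq> \<Union> (cyl ` D)"
  proof
    fix x assume x: "x \<in> A"
    then have xX: "x \<in> X"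
      using AX by blast
    obtain m where m: "Q (pref m x)"
      using Q x by blast
    obtain n where n: "cyl (pref n x) \<subseteq> A"
      using A x by (auto simp: clopen_def openin_iff_cyl)
    let ?w = "pref (max m n) x"
    have "?w = pref m x @ pref (max m n - m) ((shift ^^ m) x)"
      using pref_conc[of "pref m x" "max m n" "(shift ^^ m) x"] by (simp add: pref_conc_shift)
    then have "Q ?w"
      using Q_append[OF m, of "pref (max m n - m) ((shift ^^ m) x)"] xX by simp
    moreover have "cyl ?w \<subseteq> A"
      using n cyl_pref_mono[OF xX, of n "max m n"] by simp
    ultimately have "?w \<in> D"
      using xX by (simp add: D_def)
    then show "x \<in> \<Union> (cyl ` D)"
      using in_cyl_pref[OF xX] by (rule UN_I)
  qed
  have "compactin T A"
    using A compact_space_T closedin_compact_space by (auto simp: clopen_def)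
  moreover have "openin T U" if "U \<in> cyl ` D" for U
    using openin_cyl that by (auto simp: D_def)
  ultimately obtain F where F: "finite F" "F \<subseteq> cyl ` D" "A \<subseteq> \<Union> F"
    using compactinD[OF _ _ cover, of T] by metis
  obtain E where E: "E \<subseteq> D" "finite E" "F = cyl ` E"
    using finite_subset_image[OF F(1,2)] by metis
  have cover_E: "A \<subseteq> \<Union> (cyl ` E)"
    using F(3) E(3) by simp
  define L where "L = Max (length ` E)"
  have L: "length w \<le> L" if "w \<in> E" for w
    unfolding L_def by (rule Max_ge) (use that E(2) in simp_all)
  have key: "Q (pref L x) \<and> cyl (pref L x) \<subseteq> A" if xA: "x \<in> A" for x
  proof -
    have xX: "x \<in> X"
      using AX xA by blast
    obtain w where w: "w \<in> E" "x \<in> cyl w"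
      using cover_E xA by blast
    then obtain z where z: "z \<in> X" "x = w \<frown> z"
      unfolding cyl_def by blast
    have eq: "pref L x = w @ pref (L - length w) z"
      using z(2) L[OF w(1)] by (simp add: pref_conc)
    have "Q w" "cyl w \<subseteq> A"
      using w(1) E(1) unfolding D_def by blast+
    then show ?thesis
      using Q_append[of w "pref (L - length w) z"] z(1)
        cyl_append_subset[of "pref (L - length w) z" w] by (simp add: eq)
  qed
  have pA: "pref L ` A \<subseteq> {w. set w \<subseteq> {1..N} \<and> length w = L}"
    using AX pref_in_words by (auto simp: words_def)
  have "finite (pref L ` A)"
    by (rule finite_subset[OF pA finite_lists_length_eq]) simp
  moreover have "disjoint_family_on cyl (pref L ` A)"
    unfolding disjoint_family_on_def
  proof (intro ballI impI equals0I)
    fix u v x assume uv: "u \<in> pref L ` A" "v \<in> pref L ` A" "u \<noteq> v" and x: "x \<in> cyl u \<inter> cyl v"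
    have "pref (length u) x = u" "pref (length v) x = v" "length u = length v"
      using uv x AX by (auto simp: in_cyl_iff subset_iff)
    then show False
      using uv(3) by simp
  qed
  moreover have "A = \<Union> (cyl ` pref L ` A)"
  proof (intro equalityI subsetI)
    fix x assume x: "x \<in> A"
    then have "x \<in> cyl (pref L x)"
      using AX by (simp add: subset_iff)
    then show "x \<in> \<Union> (cyl ` pref L ` A)"
      using x by blast
  qed (use key in blast)
  moreover have "pref L ` A \<subseteq> words"
    using AX by (auto simp: subset_iff)
  ultimately have "cylinder_partition (pref L ` A) A"
    by (simp add: cylinder_partition_def)
  then show thesis
    using that key by blast
qed

lemma clopen_has_partition:
  assumes "clopen A"
  obtains S where "cylinder_partition S A"
  using clopen_refined_partition[OF assms, of "\<lambda>_. True"] by blast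

lemma closedin_cyl:
  assumes "w \<in> words"
  shows "closedin T (cyl w)"
proof -
  have "openin T (X - cyl w)"
    unfolding openin_iff_cyl
  proof (intro conjI ballI exI)
    fix x assume x: "x \<in> X - cyl w"
    show "cyl (pref (length w) x) \<subseteq> X - cyl w"
    proof
      fix y assume y: "y \<in> cyl (pref (length w) x)"
      then have "y \<in> X" "pref (length w) y = pref (length w) x"
        using x by (simp_all add: in_cyl_pref_iff pref_eq_iff)
      then show "y \<in> X - cyl w"
        using x by (simp add: in_cyl_iff[OF assms])
    qed
  qed auto
  then show ?thesis
    by (simp add: closedin_def cyl_subset_X[OF assms])
qed

lemma cylinder_partition_clopen: "cylinder_partition S A \<Longrightarrow> clopen A"
  unfolding cylinder_partition_def clopen_def
  by (auto intro!: openin_Union closedin_Union openin_cyl closedin_cyl)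

lemma cylinder_partition_empty_iff: "cylinder_partition S A \<Longrightarrow> A = {} \<longleftrightarrow> S = {}"
  using cyl_nonempty by (auto simp: cylinder_partition_def)

text \<open>A word common to both partitions would put its nonempty cylinder into
  \<open>A \<inter> B\<close>. The disjointness of \<open>S\<close> and \<open>S'\<close> is what
  makes cardinalities add.\<close>

lemma cylinder_partition_Un:
  assumes "cylinder_partition S A" "cylinder_partition S' B" "A \<inter> B = {}"
  shows "cylinder_partition (S \<union> S') (A \<union> B)" "S \<inter> S' = {}"
proof -
  show "S \<inter> S' = {}"
  proof (rule equals0I)
    fix w assume "w \<in> S \<inter> S'"
    then have "cyl w \<subseteq> A \<inter> B"
      using assms(1,2) by (auto simp: cylinder_partition_def)
    then show False
      using assms(3) cyl_nonempty by simp
  qed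
  have "cyl u \<inter> cyl v = {}" if "u \<in> S" "v \<in> S'" for u v
    using assms that unfolding cylinder_partition_def by blast
  then have "disjoint_family_on cyl (S \<union> S')"
    using assms(1,2) unfolding cylinder_partition_def disjoint_family_on_def
    by (metis UnE inf_commute)
  then show "cylinder_partition (S \<union> S') (A \<union> B)"
    using assms(1,2) unfolding cylinder_partition_def by (simp add: UN_Un)
qed

text \<open>Both cardinalities are congruent to the number of words of a large length \<open>L\<close> that begin a
  sequence in \<open>A\<close>, since \<open>N ^ k\<close> is \<open>1\<close> modulo \<open>N - 1\<close>.\<close>

lemma cylinder_partition_card_cong:
  assumes "cylinder_partition S A" "cylinder_partition S' A"
  shows "[card S = card S'] (mod (N - 1))"
proof -
  \<comment> \<open>Inserting 0 keeps \<open>Max\<close> meaningful when both partitions are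
    empty.\<close>
  define L where "L = Max (insert 0 (length ` (S \<union> S')))"
  have fin: "finite (S \<union> S')"
    using assms by (simp add: cylinder_partition_def)
  have L: "length w \<le> L" if "w \<in> S \<union> S'" for w
    unfolding L_def by (rule Max_ge) (use that fin in auto)
  have *: "[card (pref L ` A) = card S] (mod (N - 1))"
    if S: "cylinder_partition S A" and L: "\<And>w. w \<in> S \<Longrightarrow> length w \<le> L" for S
  proof -
    have SW: "S \<subseteq> words" and fS: "finite S" and A: "A = \<Union> (cyl ` S)"
      and dS: "disjoint_family_on cyl S"
      using S by (auto simp: cylinder_partition_def)
    \<comment> \<open>The words of length \<open>L\<close> starting in \<open>cyl w\<close> are the
      extensions of \<open>w\<close> by arbitrary words of the missing length, so there are
      \<open>N ^ (L - length w)\<close> of them.\<close>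
    have img: "pref L ` cyl w = (@) w ` {v. set v \<subseteq> {1..N} \<and> length v = L - length w}"
      if w: "w \<in> S" for w
    proof (intro equalityI subsetI)
      fix u assume "u \<in> pref L ` cyl w"
      then obtain z where z: "z \<in> X" "u = pref L (w \<frown> z)"
        by (auto simp: cyl_def)
      then have "u = w @ pref (L - length w) z"
        using L[OF w] by (simp add: pref_conc)
      moreover have "set (pref (L - length w) z) \<subseteq> {1..N}"
        using z(1) pref_in_words unfolding words_def lists_eq_set by blast
      ultimately show "u \<in> (@) w ` {v. set v \<subseteq> {1..N} \<and> length v = L - length w}"
        by auto
    next
      fix u assume "u \<in> (@) w ` {v. set v \<subseteq> {1..N} \<and> length v = L - length w}"
      then obtain v where v: "v \<in> words" "length v = L - length w" "u = w @ v"
        by (auto simp: words_def lists_eq_set)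
      obtain z where z: "z \<in> X"
        using X_nonempty by blast
      have "pref L (w \<frown> v \<frown> z) = w @ pref (length v) (v \<frown> z)"
        using L[OF w] v(2) by (simp add: pref_conc)
      then have "pref L (w \<frown> v \<frown> z) = u"
        by (simp add: v(3))
      moreover have "w \<frown> v \<frown> z \<in> cyl w"
        using z v by simp
      ultimately show "u \<in> pref L ` cyl w"
        by blast
    qed
    have card: "card (pref L ` cyl w) = N ^ (L - length w)" if w: "w \<in> S" for w
    proof -
      have "card ((@) w ` B) = card B" for B
        by (rule card_image) (simp add: inj_on_def)
      then show ?thesis
        using card_lists_length_eq[of "{1..N}" "L - length w"] by (simp add: img[OF w])
    qed
    have disj: "pref L ` cyl v \<inter> pref L ` cyl w = {}" if "v \<in> S" "w \<in> S" "v \<noteq> w" for v w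
    proof (rule ccontr)
      assume "pref L ` cyl v \<inter> pref L ` cyl w \<noteq> {}"
      then obtain x y where xy: "x \<in> cyl v" "y \<in> cyl w" "pref L x = pref L y"
        by blast
      then have "pref (length v) x = pref (length v) y"
        using L[OF that(1)] by (auto simp: pref_eq_iff)
      then have "y \<in> cyl v"
        using xy that SW in_cyl_iff by (metis subsetD)
      then show False
        using xy that dS by (auto simp: disjoint_family_on_def)
    qed
    have "pref L ` A = (\<Union>w\<in>S. pref L ` cyl w)"
      using A by blast
    moreover have "finite (pref L ` cyl w)" if "w \<in> S" for w
      using card[OF that] N_gt_1 by (intro card_ge_0_finite) simp
    ultimately have "card (pref L ` A) = (\<Sum>w\<in>S. N ^ (L - length w))"
      using card_UN_disjoint[of S "\<lambda>w. pref L ` cyl w"] fS disj card by simp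
    moreover have "[(\<Sum>w\<in>S. N ^ (L - length w)) = (\<Sum>w\<in>S. 1)] (mod (N - 1))"
    proof (rule cong_sum)
      fix w
      have "[N = 1] (mod (N - 1))"
        using N_gt_1 by (simp add: cong_altdef_nat)
      then show "[N ^ (L - length w) = 1] (mod (N - 1))"
        using cong_pow by fastforce
    qed
    ultimately show ?thesis
      by simp
  qed
  show ?thesis
    using *[OF assms(1)] *[OF assms(2)] L cong_trans cong_sym by blast
qed

text \<open>Splitting one word \<open>w\<close> into its \<open>N\<close> one-letter extensions
  leaves the covered set alone and raises the cardinality by \<open>N - 1\<close>. Nonemptiness
  supplies a word to split.\<close>

lemma cylinder_partition_grow:
  assumes S: "cylinder_partition S A" and "S \<noteq> {}"
  obtains S' where "cylinder_partition S' A" "card S' = card S + t * (N - 1)"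
proof -
  have "\<exists>S'. cylinder_partition S' A \<and> card S' = card S + t * (N - 1)"
  proof (induction t)
    case 0
    then show ?case
      using S by auto
  next
    case (Suc t)
    then obtain S' where S': "cylinder_partition S' A" "card S' = card S + t * (N - 1)"
      by blast
    then have fS': "finite S'" and "S' \<noteq> {}"
      using assms cylinder_partition_empty_iff by (auto simp: cylinder_partition_def)
    then obtain w where w: "w \<in> S'"
      by blast
    then have ww: "w \<in> words"
      using S' by (auto simp: cylinder_partition_def)
    define R where "R = (\<lambda>i. w @ [i]) ` {1..N}"
    have inj: "inj_on (\<lambda>i. w @ [i]) {1..N}"
      by (simp add: inj_on_def)
    have cylR: "cyl w = \<Union> (cyl ` R)"
    proof (intro equalityI subsetI)
      fix x assume "x \<in> cyl w"
      then obtain z where z: "z \<in> X" "x = w \<frown> z"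
        by (auto simp: cyl_def)
      have "x = (w @ [z 0]) \<frown> shift z"
        using pref_conc_shift[of 1 z] z(2) by (simp add: pref_def)
      moreover have "shift z \<in> X" "z 0 \<in> {1..N}"
        using z(1) by (auto simp: topspace_full_shift_space shift_def)
      ultimately show "x \<in> \<Union> (cyl ` R)"
        unfolding R_def cyl_def by blast
    next
      fix x assume "x \<in> \<Union> (cyl ` R)"
      then obtain i where i: "i \<in> {1..N}" "x \<in> cyl (w @ [i])"
        unfolding R_def by blast
      then show "x \<in> cyl w"
        using cyl_append_subset[of "[i]" w] by (meson singleton_in_words subsetD)
    qed
    have dR: "disjoint_family_on cyl R"
      unfolding disjoint_family_on_def
    proof (intro ballI impI equals0I)
      fix u v x assume uv: "u \<in> R" "v \<in> R" "u \<noteq> v" and x: "x \<in> cyl u \<inter> cyl v"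
      then obtain y z where "u \<frown> y = v \<frown> z"
        by (auto simp: cyl_def)
      moreover have "length u = length v"
        using uv by (auto simp: R_def)
      ultimately show False
        using uv(3) conc_eq_iff by blast
    qed
    have pR: "cylinder_partition R (cyl w)"
      using cylR dR ww by (auto simp: cylinder_partition_def R_def)
    have "cylinder_partition (S' - {w}) (\<Union> (cyl ` (S' - {w})))"
      using S'(1) by (auto simp: cylinder_partition_def disjoint_family_on_def)
    moreover have "\<Union> (cyl ` (S' - {w})) \<inter> cyl w = {}"
      using S'(1) w by (auto simp: cylinder_partition_def disjoint_family_on_def)
    ultimately have "cylinder_partition ((S' - {w}) \<union> R) (\<Union> (cyl ` (S' - {w})) \<union> cyl w)"
      and disj: "(S' - {w}) \<inter> R = {}"
      using cylinder_partition_Un[OF _ pR] by blast+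
    moreover have "\<Union> (cyl ` (S' - {w})) \<union> cyl w = A"
      using S'(1) w by (auto simp: cylinder_partition_def)
    moreover have "card ((S' - {w}) \<union> R) = card S + Suc t * (N - 1)"
    proof -
      have "card ((S' - {w}) \<union> R) = (card S' - 1) + N"
        using disj fS' w inj by (subst card_Un_disjoint) (auto simp: R_def card_image)
      moreover have "card S' \<ge> 1"
        using fS' w by (metis One_nat_def Suc_leI card_gt_0_iff empty_iff)
      ultimately show ?thesis
        using S'(2) N_gt_1 by simp
    qed
    ultimately show ?case
      by metis
  qed
  then show thesis
    using that by blast
qed


section \<open>Locally prefix replacing maps\<close>

text \<open>Pointwise substitute for the functions \<open>k\<close> and \<open>l\<close> of the full
  group: on the cylinder of \<open>u\<close> they can be taken to be the lengths of \<open>v\<close>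
  and \<open>u\<close>.\<close>

definition locally_prefix_replacing :: "((nat \<Rightarrow> nat) \<Rightarrow> (nat \<Rightarrow> nat)) \<Rightarrow> (nat \<Rightarrow> nat) \<Rightarrow> bool"
  where "locally_prefix_replacing f x \<longleftrightarrow>
    (\<exists>u\<in>words. \<exists>v\<in>words. \<exists>z\<in>X. x = u \<frown> z \<and> (\<forall>y\<in>X. f (u \<frown> y) = v \<frown> y))"

lemma locally_prefix_replacingI:
  assumes "u \<in> words" "v \<in> words" "z \<in> X" "x = u \<frown> z" "\<And>y. y \<in> X \<Longrightarrow> f (u \<frown> y) = v \<frown> y"
  shows "locally_prefix_replacing f x"
  using assms unfolding locally_prefix_replacing_def by blast

text \<open>The property depends only on the map near \<open>x\<close>, since \<open>u\<close> and
  \<open>v\<close> may be lengthened by the same letters until the cylinder fits into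
  \<open>A\<close>. This allows maps to be glued from pieces on open sets.\<close>

lemma locally_prefix_replacing_cong:
  assumes "openin T A" "x \<in> A" "\<And>y. y \<in> A \<Longrightarrow> g y = f y" "locally_prefix_replacing f x"
  shows "locally_prefix_replacing g x"
proof -
  obtain u v z where uvz: "u \<in> words" "v \<in> words" "z \<in> X" "x = u \<frown> z"
    "\<And>y. y \<in> X \<Longrightarrow> f (u \<frown> y) = v \<frown> y"
    using assms(4) unfolding locally_prefix_replacing_def by blast
  obtain n where n: "cyl (pref n x) \<subseteq> A"
    using assms(1,2) unfolding openin_iff_cyl by blast
  \<comment> \<open>With \<open>n\<close> further letters the new prefix has length at least
    \<open>n\<close>, so its cylinder lies inside the one of \<open>pref n x\<close>.\<close>
  let ?w = "pref n z" and ?z = "(shift ^^ n) z"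
  show ?thesis
  proof (rule locally_prefix_replacingI)
    show "u @ ?w \<in> words" "v @ ?w \<in> words" "?z \<in> X" "x = (u @ ?w) \<frown> ?z"
      using uvz(1-4) by (simp_all add: pref_conc_shift)
    fix y assume y: "y \<in> X"
    have "(u @ ?w) \<frown> y \<in> cyl (pref n x)"
    proof -
      have "pref n (u \<frown> ?w \<frown> y) = pref n (u \<frown> z)"
        by (auto simp: pref_eq_iff conc_def pref_def)
      moreover have "x \<in> X" "u \<frown> ?w \<frown> y \<in> X"
        using uvz y by simp_all
      ultimately show ?thesis
        by (simp add: in_cyl_iff uvz(4))
    qed
    then have "g ((u @ ?w) \<frown> y) = f (u \<frown> ?w \<frown> y)"
      using n assms(3) by auto
    also have "\<dots> = v \<frown> ?w \<frown> y"
      using uvz(3,5) y by simp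
    finally show "g ((u @ ?w) \<frown> y) = (v @ ?w) \<frown> y"
      by simp
  qed
qed

text \<open>The output prefix \<open>v\<close> of \<open>f\<close> and the input prefix
  \<open>u'\<close> of \<open>g\<close> both begin \<open>f x\<close>, so one extends the other.
  Lengthening the shorter rule by the excess makes them match.\<close>

lemma locally_prefix_replacing_comp:
  assumes "locally_prefix_replacing f x" "locally_prefix_replacing g (f x)"
  shows "locally_prefix_replacing (g \<circ> f) x"
proof -
  obtain u v z where f: "u \<in> words" "v \<in> words" "z \<in> X" "x = u \<frown> z"
    "\<And>y. y \<in> X \<Longrightarrow> f (u \<frown> y) = v \<frown> y"
    using assms(1) unfolding locally_prefix_replacing_def by blast
  obtain u' v' z' where g: "u' \<in> words" "v' \<in> words" "z' \<in> X" "f x = u' \<frown> z'"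
    "\<And>y. y \<in> X \<Longrightarrow> g (u' \<frown> y) = v' \<frown> y"
    using assms(2) unfolding locally_prefix_replacing_def by blast
  have eq: "v \<frown> z = u' \<frown> z'"
    using f g by simp
  show ?thesis
  proof (cases "length u' \<le> length v")
    case True
    then obtain w where w: "v = u' @ w" "z' = w \<frown> z"
      using conc_eq_conc_decomp[OF eq[symmetric]] by blast
    then show ?thesis
      using f g by (intro locally_prefix_replacingI[of u "v' @ w" z]) auto
  next
    case False
    then obtain w where w: "u' = v @ w" "z = w \<frown> z'"
      using conc_eq_conc_decomp[OF eq] by (metis nat_le_linear)
    then show ?thesis
      using f g by (intro locally_prefix_replacingI[of "u @ w" v' z']) auto
  qed
qed

lemma locally_prefix_replacing_id: "x \<in> X \<Longrightarrow> locally_prefix_replacing (\<lambda>x. x) x"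
  by (rule locally_prefix_replacingI[of "[]" "[]" x]) auto

text \<open>Continuity into a discrete space is local constancy. The codomain is arbitrary, so that
  the lemma serves both numerical functions and predicates.\<close>

lemma continuous_map_discrete_iff:
  "continuous_map T (discrete_topology UNIV) g \<longleftrightarrow> (\<forall>x\<in>X. \<exists>n. \<forall>y\<in>cyl (pref n x). g y = g x)"
proof
  assume g: "continuous_map T (discrete_topology UNIV) g"
  show "\<forall>x\<in>X. \<exists>n. \<forall>y\<in>cyl (pref n x). g y = g x"
  proof
    fix x assume x: "x \<in> X"
    have "openin T {y \<in> X. g y \<in> {g x}}"
      using g by (rule openin_continuous_map_preimage) simp
    then obtain n where "cyl (pref n x) \<subseteq> {y \<in> X. g y \<in> {g x}}"
      using x unfolding openin_iff_cyl by blast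
    then show "\<exists>n. \<forall>y\<in>cyl (pref n x). g y = g x"
      by blast
  qed
next
  assume *: "\<forall>x\<in>X. \<exists>n. \<forall>y\<in>cyl (pref n x). g y = g x"
  have "openin T {x \<in> X. g x \<in> U}" for U
    unfolding openin_iff_cyl
  proof (intro conjI ballI)
    fix x assume x: "x \<in> {x \<in> X. g x \<in> U}"
    then obtain n where n: "\<forall>y\<in>cyl (pref n x). g y = g x"
      using * by blast
    moreover have "cyl (pref n x) \<subseteq> X"
      using x by (simp add: cyl_subset_X)
    ultimately have "cyl (pref n x) \<subseteq> {x \<in> X. g x \<in> U}"
      using x by auto
    then show "\<exists>n. cyl (pref n x) \<subseteq> {x \<in> X. g x \<in> U}" ..
  qed auto
  then show "continuous_map T (discrete_topology UNIV) g"
    by (simp add: continuous_map_def)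
qed

lemma locally_prefix_replacing_continuous:
  assumes "\<And>x. x \<in> X \<Longrightarrow> f x \<in> X" "\<And>x. x \<in> X \<Longrightarrow> locally_prefix_replacing f x"
  shows "continuous_map T T f"
  unfolding continuous_map_def
proof (intro conjI allI impI)
  show "f \<in> X \<rightarrow> X"
    using assms(1) by blast
  fix U assume U: "openin T U"
  show "openin T {x \<in> X. f x \<in> U}"
    unfolding openin_iff_cyl
  proof (intro conjI ballI)
    fix x assume x: "x \<in> {x \<in> X. f x \<in> U}"
    then obtain n where n: "cyl (pref n (f x)) \<subseteq> U"
      using U unfolding openin_iff_cyl by blast
    obtain u v z where f: "u \<in> words" "v \<in> words" "z \<in> X" "x = u \<frown> z"
      "\<And>y. y \<in> X \<Longrightarrow> f (u \<frown> y) = v \<frown> y"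
      using assms(2) x unfolding locally_prefix_replacing_def by blast
    \<comment> \<open>Fixing \<open>n\<close> letters beyond \<open>u\<close> fixes all letters of
      \<open>v @ pref n z\<close> in the image, hence at least its first \<open>n\<close>.\<close>
    have "pref (length u + n) x = u @ pref n z"
      unfolding f(4) by (subst pref_conc) auto
    moreover have "cyl (u @ pref n z) \<subseteq> {x \<in> X. f x \<in> U}"
    proof
      fix y assume "y \<in> cyl (u @ pref n z)"
      then obtain y' where y': "y' \<in> X" "y = u \<frown> pref n z \<frown> y'"
        by (auto simp: cyl_def)
      have fy: "f y = v \<frown> pref n z \<frown> y'"
        unfolding y'(2) using f(3,5) y'(1) by simp
      have fx: "f x = v \<frown> z"
        using f by simp
      have "pref n (f y) = pref n (f x)"
        unfolding fx fy by (auto simp: pref_eq_iff conc_def pref_def)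
      moreover have "y \<in> X"
        using y' f by simp
      ultimately have "f y \<in> cyl (pref n (f x))"
        using x assms(1) by (simp add: in_cyl_iff)
      then show "y \<in> {x \<in> X. f x \<in> U}"
        using n \<open>y \<in> X\<close> by blast
    qed
    ultimately show "\<exists>n. cyl (pref n x) \<subseteq> {x \<in> X. f x \<in> U}"
      by metis
  qed auto
qed

section \<open>Full group elements as locally prefix replacing bijections\<close>

lemma shift_funpow_conc_drop: "n \<le> length u \<Longrightarrow> (shift ^^ n) (u \<frown> y) = drop n u \<frown> y"
  by (auto simp: shift_funpow conc_def fun_eq_iff add.commute intro!: arg_cong[where f = y])

text \<open>Near \<open>x\<close> the functions \<open>k\<close>, \<open>l\<close> and the first
  \<open>k x\<close> letters of the image are constant. The remaining letters of the image are
  forced by the shift identity to be those of the argument after the first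
  \<open>l x\<close>.\<close>

lemma carrier_locally_prefix_replacing:
  assumes \<tau>: "\<tau> \<in> continuous_full_group_carrier N" and x: "x \<in> X"
  shows "locally_prefix_replacing \<tau> x"
proof -
  obtain k l where kl: "continuous_map T (discrete_topology UNIV) k"
      "continuous_map T (discrete_topology UNIV) l"
      "\<And>x. x \<in> X \<Longrightarrow> (shift ^^ k x) (\<tau> x) = (shift ^^ l x) x"
    using \<tau> unfolding continuous_full_group_carrier_def by blast
  have cont: "continuous_map T T \<tau>"
    using \<tau> homeomorphic_imp_continuous_map unfolding continuous_full_group_carrier_def by blast
  have \<tau>X: "\<tau> y \<in> X" if "y \<in> X" for y
    using cont that unfolding continuous_map_def by blast
  obtain n1 where n1: "\<forall>y\<in>cyl (pref n1 x). k y = k x"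
    using kl(1) x unfolding continuous_map_discrete_iff by blast
  obtain n2 where n2: "\<forall>y\<in>cyl (pref n2 x). l y = l x"
    using kl(2) x unfolding continuous_map_discrete_iff by blast
  let ?v = "pref (k x) (\<tau> x)"
  have "openin T {y \<in> X. \<tau> y \<in> cyl ?v}"
    using openin_continuous_map_preimage[OF cont openin_cyl] x \<tau>X by simp
  then obtain n3 where n3: "cyl (pref n3 x) \<subseteq> {y \<in> X. \<tau> y \<in> cyl ?v}"
    using x \<tau>X unfolding openin_iff_cyl by (metis (no_types, lifting) in_cyl_pref mem_Collect_eq)
  \<comment> \<open>The depth is large enough for the three local constancies, and at least
    \<open>l x\<close>, so that dropping \<open>l x\<close> letters stays within the prefix.\<close>
  define n where "n = Max {n1, n2, n3, l x}"
  have n: "n1 \<le> n" "n2 \<le> n" "n3 \<le> n" "l x \<le> n"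
    by (simp_all add: n_def)
  let ?u = "pref n x"
  show ?thesis
  proof (rule locally_prefix_replacingI)
    show "?u \<in> words" "?v @ drop (l x) ?u \<in> words" "(shift ^^ n) x \<in> X"
      using x \<tau>X pref_in_words[OF x, of n] append_in_words[of "take (l x) ?u" "drop (l x) ?u"]
      by simp_all
    show "x = ?u \<frown> (shift ^^ n) x"
      by (simp add: pref_conc_shift)
    fix y assume y: "y \<in> X"
    let ?y = "?u \<frown> y"
    have "?y \<in> cyl ?u"
      using y by simp
    then have *: "?y \<in> cyl (pref m x)" if "m \<le> n" for m
      using cyl_pref_mono[OF x that] by blast
    have eq: "k ?y = k x" "l ?y = l x" "\<tau> ?y \<in> cyl ?v"
      using *[OF n(1)] *[OF n(2)] *[OF n(3)] n1 n2 n3 by blast+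
    have "\<tau> ?y = pref (k x) (\<tau> ?y) \<frown> (shift ^^ k x) (\<tau> ?y)"
      by (simp add: pref_conc_shift)
    also have "pref (k x) (\<tau> ?y) = ?v"
      using eq(3) x \<tau>X by (simp add: in_cyl_iff)
    also have "(shift ^^ k x) (\<tau> ?y) = (shift ^^ l x) ?y"
      using kl(3)[of ?y] eq x y by simp
    also have "(shift ^^ l x) ?y = drop (l x) ?u \<frown> y"
      using n(4) by (simp add: shift_funpow_conc_drop)
    finally show "\<tau> ?y = (?v @ drop (l x) ?u) \<frown> y"
      by simp
  qed
qed

lemma carrier_bij_betw: "\<tau> \<in> continuous_full_group_carrier N \<Longrightarrow> bij_betw \<tau> X X"
  unfolding continuous_full_group_carrier_def bij_betw_def
  using homeomorphic_imp_injective_map homeomorphic_imp_surjective_map by blast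

text \<open>A continuous bijection of a compact Hausdorff space is a homeomorphism, so the work lies
  in choosing \<open>k\<close> and \<open>l\<close> continuously: \<open>l\<close> is the depth of a
  replaced prefix and \<open>k\<close> the length of its replacement.\<close>

lemma locally_prefix_replacing_in_carrier:
  assumes ext: "\<tau> \<in> extensional X" and bij: "bij_betw \<tau> X X"
    and lpr: "\<And>x. x \<in> X \<Longrightarrow> locally_prefix_replacing \<tau> x"
  shows "\<tau> \<in> continuous_full_group_carrier N"
proof -
  have \<tau>X: "\<tau> x \<in> X" if "x \<in> X" for x
    using bij that bij_betwE by blast
  then have cont: "continuous_map T T \<tau>"
    using locally_prefix_replacing_continuous lpr by blast
  have homeo: "homeomorphic_map T T \<tau>"
    by (rule continuous_imp_homeomorphic_map[OF cont compact_space_T Hausdorff_space_T])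
      (use bij in \<open>auto simp: bij_betw_def\<close>)
  define good where "good = (\<lambda>w v. \<forall>y\<in>X. \<tau> (w \<frown> y) = v \<frown> y)"
  define l where "l = (\<lambda>x. LEAST n. \<exists>v. good (pref n x) v)"
  \<comment> \<open>The choice is made from the word \<open>pref (l x) x\<close> alone, so points
    with the same word receive the same value.\<close>
  define k where "k = (\<lambda>x. length (SOME v. good (pref (l x) x) v))"
  have ex: "\<exists>n v. good (pref n x) v" if x: "x \<in> X" for x
  proof -
    obtain u v z where "x = u \<frown> z" "\<And>y. y \<in> X \<Longrightarrow> \<tau> (u \<frown> y) = v \<frown> y"
      using lpr[OF x] unfolding locally_prefix_replacing_def by blast
    then have "good (pref (length u) x) v"
      by (simp add: good_def)
    then show ?thesis
      by blast
  qed
  have l: "\<exists>v. good (pref (l x) x) v" if "x \<in> X" for x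
    unfolding l_def using ex[OF that] by (rule LeastI_ex)
  have l_le: "l x \<le> n" if "good (pref n x) v" for x n v
    unfolding l_def using that by (intro Least_le) blast
  \<comment> \<open>The least depth \<open>l x\<close> works, with the same replacement, on the whole cylinder of \<open>x\<close>.\<close>
  have const: "l y = l x \<and> k y = k x" if x: "x \<in> X" and y: "y \<in> cyl (pref (l x) x)" for x y
  proof -
    have yX: "y \<in> X" and eq: "\<forall>i<l x. y i = x i"
      using x y by (simp_all add: in_cyl_pref_iff)
    have "l y \<le> l x"
      using l[OF x] l_le eq by (metis pref_eq_iff)
    moreover from this have "pref (l y) y = pref (l y) x"
      using eq by (simp add: pref_eq_iff)
    then have "l x \<le> l y"
      using l[OF yX] l_le by metis
    ultimately have "l y = l x"
      by simp
    then show ?thesis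
      using \<open>pref (l y) y = pref (l y) x\<close> by (simp add: k_def)
  qed
  have "(shift ^^ k x) (\<tau> x) = (shift ^^ l x) x" if x: "x \<in> X" for x
  proof -
    define v where "v = (SOME v. good (pref (l x) x) v)"
    have "good (pref (l x) x) v"
      unfolding v_def using l[OF x] by (rule someI_ex)
    then have "\<tau> (pref (l x) x \<frown> (shift ^^ l x) x) = v \<frown> (shift ^^ l x) x"
      using x by (simp add: good_def)
    then show ?thesis
      by (simp add: pref_conc_shift k_def v_def[symmetric] shift_funpow_conc)
  qed
  moreover have "continuous_map T (discrete_topology UNIV) k"
    "continuous_map T (discrete_topology UNIV) l"
    unfolding continuous_map_discrete_iff using const by blast+
  ultimately show ?thesis
    unfolding continuous_full_group_carrier_def using ext homeo by blast
qed

text \<open>Turns local rules into a finite table. A rule from \<open>u\<close> to \<open>v\<close>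
  restricts to one from \<open>u @ w\<close> to \<open>v @ w\<close>, so replaceability is inherited
  by longer words and the refinement lemma applies.\<close>

lemma clopen_replacement_partition:
  assumes A: "clopen A" and f: "\<And>x. x \<in> A \<Longrightarrow> locally_prefix_replacing f x"
  obtains S g where "cylinder_partition S A" "\<And>w. w \<in> S \<Longrightarrow> g w \<in> words"
    "\<And>w y. w \<in> S \<Longrightarrow> y \<in> X \<Longrightarrow> f (w \<frown> y) = g w \<frown> y"
proof -
  define Q where "Q = (\<lambda>w. \<exists>v\<in>words. \<forall>y\<in>X. f (w \<frown> y) = v \<frown> y)"
  have "\<exists>n. Q (pref n x)" if x: "x \<in> A" for x
  proof -
    obtain u v z where uvz: "v \<in> words" "x = u \<frown> z" "\<And>y. y \<in> X \<Longrightarrow> f (u \<frown> y) = v \<frown> y"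
      using f[OF x] unfolding locally_prefix_replacing_def by blast
    then have "Q (pref (length u) x)"
      by (auto simp: Q_def)
    then show ?thesis ..
  qed
  moreover have "Q (u @ w)" if "Q u" "w \<in> words" for u w
  proof -
    obtain v where "v \<in> words" "\<forall>y\<in>X. f (u \<frown> y) = v \<frown> y"
      using \<open>Q u\<close> by (auto simp: Q_def)
    then have "v @ w \<in> words \<and> (\<forall>y\<in>X. f ((u @ w) \<frown> y) = (v @ w) \<frown> y)"
      using that(2) by simp
    then show ?thesis
      unfolding Q_def by blast
  qed
  ultimately obtain S where S: "cylinder_partition S A" "\<And>w. w \<in> S \<Longrightarrow> Q w"
    using clopen_refined_partition[OF A, of Q] by blast
  then have "\<forall>w\<in>S. \<exists>v. v \<in> words \<and> (\<forall>y\<in>X. f (w \<frown> y) = v \<frown> y)"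
    by (auto simp: Q_def)
  then obtain g where "\<forall>w\<in>S. g w \<in> words \<and> (\<forall>y\<in>X. f (w \<frown> y) = g w \<frown> y)"
    by metis
  then show thesis
    using that[OF S(1), of g] by blast
qed

text \<open>Each cylinder is carried onto a cylinder. Injectivity of \<open>f\<close> keeps the
  images disjoint, and since cylinders are nonempty this makes \<open>g\<close> injective as
  well.\<close>

lemma cylinder_partition_image:
  assumes S: "cylinder_partition S A" and g: "\<And>w. w \<in> S \<Longrightarrow> g w \<in> words"
    and f: "\<And>w y. w \<in> S \<Longrightarrow> y \<in> X \<Longrightarrow> f (w \<frown> y) = g w \<frown> y"
    and inj: "inj_on f A"
  shows "cylinder_partition (g ` S) (f ` A)" "card (g ` S) = card S"
proof -
  have A: "A = \<Union> (cyl ` S)" and fin: "finite S"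
    using S by (auto simp: cylinder_partition_def)
  have img: "f ` cyl w = cyl (g w)" if "w \<in> S" for w
    unfolding cyl_def image_image using f[OF that] by (intro image_cong) auto
  have disj: "cyl (g u) \<inter> cyl (g v) = {}" if "u \<in> S" "v \<in> S" "u \<noteq> v" for u v
  proof -
    have "cyl u \<inter> cyl v = {}" "cyl u \<subseteq> A" "cyl v \<subseteq> A"
      using S that by (auto simp: cylinder_partition_def disjoint_family_on_def)
    then have "f ` cyl u \<inter> f ` cyl v = {}"
      using inj_on_image_Int[OF inj, of "cyl u" "cyl v"] by simp
    then show ?thesis
      using img that by simp
  qed
  have "inj_on g S"
  proof (rule inj_onI, rule ccontr)
    fix u v assume "u \<in> S" "v \<in> S" "g u = g v" "u \<noteq> v"
    then show False
      using disj[of u v] cyl_nonempty by simp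
  qed
  then show "card (g ` S) = card S"
    by (rule card_image)
  have "disjoint_family_on cyl (g ` S)"
    unfolding disjoint_family_on_def
  proof (intro ballI impI)
    fix a b assume "a \<in> g ` S" "b \<in> g ` S" "a \<noteq> b"
    then show "cyl a \<inter> cyl b = {}"
      using disj by (metis imageE)
  qed
  moreover have "f ` A = \<Union> (cyl ` g ` S)"
    unfolding A image_UN image_image using img by (intro SUP_cong) auto
  ultimately show "cylinder_partition (g ` S) (f ` A)"
    using fin g by (auto simp: cylinder_partition_def)
qed

section \<open>Counting cylinders modulo \<open>N - 1\<close>\<close>

text \<open>On clopen sets the choice of \<open>S\<close> is immaterial by
  \<open>cylinder_partition_card_cong\<close>. Storing the reduced residue lets counts be compared
  by equality.\<close>

definition cylinder_count :: "(nat \<Rightarrow> nat) set \<Rightarrow> nat"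
  where "cylinder_count A = card (SOME S. cylinder_partition S A) mod (N - 1)"

lemma cylinder_count_eq:
  assumes "cylinder_partition S A"
  shows "cylinder_count A = card S mod (N - 1)"
proof -
  have "cylinder_partition (SOME S. cylinder_partition S A) A"
    using assms by (rule someI)
  then show ?thesis
    unfolding cylinder_count_def using cylinder_partition_card_cong[OF _ assms]
    by (simp add: cong_def)
qed

lemma locally_prefix_replacing_image:
  assumes "clopen A" "\<And>x. x \<in> A \<Longrightarrow> locally_prefix_replacing f x" "inj_on f A"
  shows "clopen (f ` A)" "cylinder_count (f ` A) = cylinder_count A"
proof -
  obtain S g where S: "cylinder_partition S A" "\<And>w. w \<in> S \<Longrightarrow> g w \<in> words"
    "\<And>w y. w \<in> S \<Longrightarrow> y \<in> X \<Longrightarrow> f (w \<frown> y) = g w \<frown> y"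
    using clopen_replacement_partition[OF assms(1,2)] by blast
  note * = cylinder_partition_image[OF S assms(3)]
  show "clopen (f ` A)"
    using *(1) by (rule cylinder_partition_clopen)
  show "cylinder_count (f ` A) = cylinder_count A"
    by (simp only: cylinder_count_eq[OF *(1)] *(2) cylinder_count_eq[OF S(1)])
qed

lemma cylinder_count_Un:
  assumes "clopen A" "clopen B" "A \<inter> B = {}"
  shows "clopen (A \<union> B)"
    "cylinder_count (A \<union> B) = (cylinder_count A + cylinder_count B) mod (N - 1)"
proof -
  obtain S S' where S: "cylinder_partition S A" and S': "cylinder_partition S' B"
    using assms(1,2) by (blast elim: clopen_has_partition)
  note * = cylinder_partition_Un[OF S S' assms(3)]
  have "finite S" "finite S'"
    using S S' by (auto simp: cylinder_partition_def)
  then have "card (S \<union> S') = card S + card S'"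
    using *(2) by (simp add: card_Un_disjoint)
  then show "cylinder_count (A \<union> B) = (cylinder_count A + cylinder_count B) mod (N - 1)"
    by (simp add: cylinder_count_eq[OF *(1)] cylinder_count_eq[OF S] cylinder_count_eq[OF S'] mod_add_eq)
  show "clopen (A \<union> B)"
    using *(1) by (rule cylinder_partition_clopen)
qed

lemma cylinder_partition_empty: "cylinder_partition {} {}"
  by (simp add: cylinder_partition_def disjoint_family_on_def)

lemma clopen_empty: "clopen {}"
  and cylinder_count_empty: "cylinder_count {} = 0"
  using cylinder_partition_clopen[OF cylinder_partition_empty]
    cylinder_count_eq[OF cylinder_partition_empty] by simp_all

lemma cylinder_partition_X: "cylinder_partition {[]} X"
  by (simp add: cylinder_partition_def disjoint_family_on_def cyl_def)

lemma cylinder_count_UN: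
  assumes "finite I" "\<And>i. i \<in> I \<Longrightarrow> clopen (A i)" "disjoint_family_on A I"
  shows "clopen (\<Union>i\<in>I. A i) \<and> cylinder_count (\<Union>i\<in>I. A i) = (\<Sum>i\<in>I. cylinder_count (A i)) mod (N - 1)"
  using assms
proof (induction I rule: finite_induct)
  case empty
  then show ?case
    by (simp add: clopen_empty cylinder_count_empty)
next
  case (insert i I)
  have "A i \<inter> (\<Union>j\<in>I. A j) = {}"
    using insert.prems(2) insert.hyps(2) by (auto simp: disjoint_family_on_def)
  moreover have "disjoint_family_on A I"
    using insert.prems(2) by (auto simp: disjoint_family_on_def)
  ultimately show ?case
    using insert.IH insert.hyps insert.prems(1) cylinder_count_Un[of "A i" "\<Union>j\<in>I. A j"]
    by (simp add: mod_add_right_eq)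
qed

text \<open>Any matching of the words of two partitions is realized by replacing each word with its
  partner and keeping the tail.\<close>

lemma cylinder_partition_bij_map:
  assumes S: "cylinder_partition S A" and S': "cylinder_partition S' B" and g: "bij_betw g S S'"
  obtains f where "bij_betw f A B" "\<And>w y. w \<in> S \<Longrightarrow> y \<in> X \<Longrightarrow> f (w \<frown> y) = g w \<frown> y"
    "\<And>x. x \<in> A \<Longrightarrow> locally_prefix_replacing f x"
proof -
  \<comment> \<open>The description is proper on \<open>A\<close>, where exactly one word of
    \<open>S\<close> is a prefix of \<open>x\<close>.\<close>
  define f where "f = (\<lambda>x. let w = THE w. w \<in> S \<and> x \<in> cyl w in g w \<frown> (shift ^^ length w) x)"
  have f: "f (w \<frown> y) = g w \<frown> y" if w: "w \<in> S" and y: "y \<in> X" for w y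
  proof -
    have "(THE v. v \<in> S \<and> w \<frown> y \<in> cyl v) = w"
    proof (rule the_equality)
      show "w \<in> S \<and> w \<frown> y \<in> cyl w"
        using w y by simp
      fix v assume "v \<in> S \<and> w \<frown> y \<in> cyl v"
      then show "v = w"
        using S w conc_in_cyl[OF y, of w]
        unfolding cylinder_partition_def disjoint_family_on_def by blast
    qed
    then show ?thesis
      by (simp add: f_def shift_funpow_conc)
  qed
  have A: "A = \<Union> (cyl ` S)" and SW: "S \<subseteq> words"
    using S by (auto simp: cylinder_partition_def)
  have B: "B = \<Union> (cyl ` S')" and S'W: "S' \<subseteq> words"
    using S' by (auto simp: cylinder_partition_def)
  have gS: "g ` S = S'"
    using g by (simp add: bij_betw_def)
  have "inj_on f A"
  proof (rule inj_onI)
    fix x y assume "x \<in> A" "y \<in> A" and eq: "f x = f y"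
    then obtain u v x' y' where *: "u \<in> S" "v \<in> S" "x' \<in> X" "y' \<in> X" "x = u \<frown> x'" "y = v \<frown> y'"
      unfolding A cyl_def by blast
    then have "g u \<frown> x' = g v \<frown> y'"
      using eq f by simp
    then have "\<not> cyl (g u) \<inter> cyl (g v) = {}"
      using * conc_in_cyl by (metis IntI empty_iff)
    then have "g u = g v"
      using S' gS *(1,2) unfolding cylinder_partition_def disjoint_family_on_def by blast
    then have "u = v"
      using g *(1,2) by (auto simp: bij_betw_def inj_on_def)
    then show "x = y"
      using \<open>g u \<frown> x' = g v \<frown> y'\<close> * by simp
  qed
  moreover have "f ` A = B"
  proof -
    have "f ` cyl w = cyl (g w)" if "w \<in> S" for w
      unfolding cyl_def image_image using f[OF that] by (intro image_cong) auto
    then have "f ` A = \<Union> (cyl ` g ` S)"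
      unfolding A image_UN image_image by (intro SUP_cong) auto
    then show ?thesis
      by (simp add: gS B)
  qed
  moreover have "locally_prefix_replacing f x" if x: "x \<in> A" for x
  proof -
    obtain w z where "w \<in> S" "z \<in> X" "x = w \<frown> z"
      using x unfolding A cyl_def by blast
    moreover from this have "g w \<in> words" "w \<in> words"
      using gS SW S'W by blast+
    ultimately show ?thesis
      using f by (intro locally_prefix_replacingI[of w "g w" z]) auto
  qed
  ultimately show thesis
    using that f by (simp add: bij_betw_def)
qed

text \<open>Splitting raises either cardinality by multiples of \<open>N - 1\<close>, so congruent
  cardinalities can be made equal and the words matched. The empty partition cannot be split, which
  is why emptiness is compared separately.\<close>

lemma cylinder_count_eq_imp_bij:
  assumes A: "clopen A" and B: "clopen B"
    and count: "cylinder_count A = cylinder_count B" and empty: "A = {} \<longleftrightarrow> B = {}"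
  obtains f where "bij_betw f A B" "\<And>x. x \<in> A \<Longrightarrow> locally_prefix_replacing f x"
proof -
  obtain S S' where S: "cylinder_partition S A" and S': "cylinder_partition S' B"
    using A B by (blast elim: clopen_has_partition)
  have "\<exists>R R'. cylinder_partition R A \<and> cylinder_partition R' B \<and> card R = card R'"
  proof (cases "A = {}")
    case True
    then show ?thesis
      using empty cylinder_partition_empty by blast
  next
    case False
    have "S \<noteq> {}"
      using False S by (simp add: cylinder_partition_empty_iff[OF S, symmetric])
    have "S' \<noteq> {}"
      using False empty by (simp add: cylinder_partition_empty_iff[OF S', symmetric])
    have "[card S = card S'] (mod (N - 1))"
      using count by (simp add: cylinder_count_eq[OF S] cylinder_count_eq[OF S'] cong_def)
    then obtain s t where "card S' + s * (N - 1) = card S + t * (N - 1)"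
      unfolding cong_iff_lin_nat by blast
    then show ?thesis
      using cylinder_partition_grow[OF S \<open>S \<noteq> {}\<close>, of t]
        cylinder_partition_grow[OF S' \<open>S' \<noteq> {}\<close>, of s] by metis
  qed
  then obtain R R' where R: "cylinder_partition R A" "cylinder_partition R' B" "card R = card R'"
    by blast
  then have "finite R" "finite R'"
    by (auto simp: cylinder_partition_def)
  then obtain g where "bij_betw g R R'"
    using R(3) finite_same_card_bij by blast
  then show thesis
    using cylinder_partition_bij_map[OF R(1,2)] that by metis
qed


section \<open>Iterates and clopen conditions\<close>

lemma locally_prefix_replacing_funpow:
  assumes "\<And>x. x \<in> X \<Longrightarrow> f x \<in> X" "\<And>x. x \<in> X \<Longrightarrow> locally_prefix_replacing f x" "x \<in> X"
  shows "(f ^^ n) x \<in> X" "locally_prefix_replacing (f ^^ n) x"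
proof -
  have "(f ^^ n) x \<in> X \<and> locally_prefix_replacing (f ^^ n) x"
  proof (induction n)
    case 0
    then show ?case
      using assms(3) locally_prefix_replacing_id by (simp add: id_def)
  next
    case (Suc n)
    then show ?case
      using assms(1,2) locally_prefix_replacing_comp[of "f ^^ n" x f] by (simp add: o_def)
  qed
  then show "(f ^^ n) x \<in> X" "locally_prefix_replacing (f ^^ n) x"
    by auto
qed

lemma clopen_Collect:
  assumes "\<And>x. x \<in> X \<Longrightarrow> \<exists>n. \<forall>y\<in>cyl (pref n x). P y = P x"
  shows "clopen {x \<in> X. P x}"
proof -
  have P: "continuous_map T (discrete_topology UNIV) P"
    unfolding continuous_map_discrete_iff using assms by blast
  show ?thesis
    using openin_continuous_map_preimage[OF P, of "{True}"]
      closedin_continuous_map_preimage[OF P, of "{True}"] by (simp add: clopen_def)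
qed

lemma clopen_less:
  fixes g h :: "(nat \<Rightarrow> nat) \<Rightarrow> nat"
  assumes "continuous_map T (discrete_topology UNIV) g" "continuous_map T (discrete_topology UNIV) h"
  shows "clopen {x \<in> X. g x < h x}"
proof (rule clopen_Collect)
  fix x assume x: "x \<in> X"
  obtain m n where m: "\<forall>y\<in>cyl (pref m x). g y = g x" and n: "\<forall>y\<in>cyl (pref n x). h y = h x"
    using assms x unfolding continuous_map_discrete_iff by blast
  have "\<forall>y\<in>cyl (pref (max m n) x). (g y < h y) = (g x < h x)"
    using m n cyl_pref_mono[OF x, of m "max m n"] cyl_pref_mono[OF x, of n "max m n"]
    by (simp add: subset_iff)
  then show "\<exists>n. \<forall>y\<in>cyl (pref n x). (g y < h y) = (g x < h x)" ..
qed

lemma clopen_Int: "clopen A \<Longrightarrow> clopen B \<Longrightarrow> clopen (A \<inter> B)"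
  by (simp add: clopen_def openin_Int closedin_Int)

lemma clopen_INT: "finite I \<Longrightarrow> clopen A \<Longrightarrow> (\<And>i. i \<in> I \<Longrightarrow> clopen (B i)) \<Longrightarrow> clopen (A \<inter> (\<Inter>i\<in>I. B i))"
proof (induction I rule: finite_induct)
  case (insert i I)
  have "A \<inter> (\<Inter>j\<in>insert i I. B j) = (A \<inter> (\<Inter>j\<in>I. B j)) \<inter> B i"
    by blast
  then show ?case
    using insert by (simp add: clopen_Int)
qed simp

text \<open>As there are two letters, some constant sequence avoids the first letter of
  \<open>w\<close>. This rules out a nonempty inserted word in a map of finite period.\<close>

lemma ex_conc_neq:
  assumes "w \<noteq> []"
  obtains y where "y \<in> X" "w \<frown> y \<noteq> y"
proof -
  obtain a where a: "a \<in> {1..N}" "a \<noteq> w ! 0"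
    using N_gt_1 by (metis atLeastAtMost_iff le_refl less_imp_le_nat nat_neq_iff)
  have "w \<frown> (\<lambda>_. a) \<noteq> (\<lambda>_. a)"
    using assms a(2) by (auto simp: conc_def fun_eq_iff intro!: exI[of _ 0])
  then show thesis
    using that const_in_X[OF a(1)] by blast
qed

end

section \<open>Maps of prime period\<close>

definition fixed_points :: "'a set \<Rightarrow> ('a \<Rightarrow> 'a) \<Rightarrow> 'a set"
  where "fixed_points S f = {x \<in> S. f x = x}"

text \<open>The identity is allowed here; that the period is exactly \<open>p\<close> is expressed
  separately by a fixed point set different from \<open>X\<close>. All conditions concern points of
  \<open>X\<close>, so the map need not be extensional.\<close>

locale prime_period = full_shift +
  fixes \<tau> :: "(nat \<Rightarrow> nat) \<Rightarrow> (nat \<Rightarrow> nat)" and p :: nat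
  assumes prime_p: "prime p"
    and in_X: "x \<in> X \<Longrightarrow> \<tau> x \<in> X"
    and lpr: "x \<in> X \<Longrightarrow> locally_prefix_replacing \<tau> x"
    and period: "x \<in> X \<Longrightarrow> (\<tau> ^^ p) x = x"
begin

abbreviation "Fix \<equiv> fixed_points X \<tau>"

lemma funpow_in_X: "x \<in> X \<Longrightarrow> (\<tau> ^^ n) x \<in> X"
  and lpr_funpow: "x \<in> X \<Longrightarrow> locally_prefix_replacing (\<tau> ^^ n) x"
  by (auto intro: locally_prefix_replacing_funpow in_X lpr)

lemma p_gt_1: "p > 1"
  using prime_p by (rule prime_gt_1_nat)

lemma funpow_mod: "x \<in> X \<Longrightarrow> (\<tau> ^^ (n mod p)) x = (\<tau> ^^ n) x"
  by (rule funpow_mod_eq) (rule period)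

lemma funpow_diff: "x \<in> X \<Longrightarrow> j \<le> p \<Longrightarrow> (\<tau> ^^ (p - j)) ((\<tau> ^^ j) x) = x"
  using period[of x] by (metis comp_apply funpow_add le_add_diff_inverse2)

text \<open>Reducing \<open>j\<close> modulo \<open>p\<close> makes the complementary power
  available, and that power undoes the given one.\<close>

lemma inj_funpow: 
  assumes "x \<in> X" "y \<in> X" "(\<tau> ^^ j) x = (\<tau> ^^ j) y"
  shows "x = y"
proof -
  have "(\<tau> ^^ (j mod p)) x = (\<tau> ^^ (j mod p)) y"
    using assms by (simp add: funpow_mod)
  then show ?thesis
    using funpow_diff[of _ "j mod p"] assms(1,2) p_gt_1 by (metis mod_less_divisor less_imp_le_nat prime_gt_0_nat prime_p)
qed

text \<open>The exponent \<open>j\<close> is invertible modulo the prime \<open>p\<close>, so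
  \<open>\<tau>\<close> acts on \<open>x\<close> as a power of \<open>\<tau> ^^ j\<close>. Hence
  every orbit outside the fixed point set has full length \<open>p\<close>.\<close>

lemma funpow_fixed:
  assumes "x \<in> X" "(\<tau> ^^ j) x = x" "0 < j" "j < p"
  shows "\<tau> x = x"
proof -
  have "coprime j p"
    using assms(3,4) prime_p by (metis coprime_commute nat_dvd_not_less prime_imp_coprime)
  then obtain k where k: "[j * k = 1] (mod p)"
    using cong_solve_coprime_nat by auto
  have "(\<tau> ^^ (j * k)) x = x"
    using assms(2) by (induction k) (simp_all add: funpow_add)
  moreover have "(\<tau> ^^ (j * k)) x = (\<tau> ^^ (1 mod p)) x"
    using k assms(1) by (metis cong_def funpow_mod)
  ultimately show ?thesis
    using p_gt_1 by simp
qed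

lemma continuous_funpow: "continuous_map T T (\<tau> ^^ n)"
  using locally_prefix_replacing_continuous funpow_in_X lpr_funpow by blast

text \<open>A prefix replacement fixing a point either is the identity nearby, or its powers
  or those of its inverse strictly contract a cylinder, so that it has infinite order.\<close>

lemma openin_fixed: "openin T Fix"
  unfolding openin_iff_cyl
proof (intro conjI ballI)
  fix x assume x: "x \<in> Fix"
  then have xX: "x \<in> X" and fx: "\<tau> x = x"
    by (auto simp: fixed_points_def)
  obtain u v z where \<tau>: "u \<in> words" "v \<in> words" "z \<in> X" "x = u \<frown> z"
    "\<And>y. y \<in> X \<Longrightarrow> \<tau> (u \<frown> y) = v \<frown> y"
    using lpr[OF xX] unfolding locally_prefix_replacing_def by blast
  have eq: "v \<frown> z = u \<frown> z"
    using \<tau> fx by simp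
  have "u = v"
  proof (cases "length u \<le> length v")
    case True
    then obtain w where w: "v = u @ w"
      using conc_eq_conc_decomp[OF eq[symmetric]] by blast
    \<comment> \<open>Each application of \<open>\<tau>\<close> inserts one copy of \<open>w\<close>
      behind \<open>u\<close>; after \<open>p\<close> applications nothing may have changed, so
      \<open>w\<close> is empty.\<close>
    define c where "c = (\<lambda>n. concat (replicate n w))"
    have ww: "w \<in> words"
      using \<tau>(2) w by simp
    have pow: "(\<tau> ^^ n) (u \<frown> y) = u \<frown> c n \<frown> y \<and> c n \<in> words" if "y \<in> X" for n y
    proof (induction n)
      case (Suc n)
      then show ?case
        using \<tau>(5)[of "c n \<frown> y"] that ww w by (simp add: c_def)
    qed (simp add: c_def)
    have "c p = []"
    proof (rule ccontr)
      assume "c p \<noteq> []"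
      then obtain y where y: "y \<in> X" "c p \<frown> y \<noteq> y"
        by (rule ex_conc_neq)
      then show False
        using pow[OF y(1), of p] period[of "u \<frown> y"] \<tau>(1) by simp
    qed
    then show ?thesis
      using w p_gt_1 by (simp add: c_def)
  next
    case False
    then obtain w where w: "u = v @ w"
      using conc_eq_conc_decomp[OF eq] by (metis nat_le_linear)
    \<comment> \<open>The mirror case: each application removes one copy of \<open>w\<close> behind
      \<open>v\<close>.\<close>
    define c where "c = (\<lambda>n. concat (replicate n w))"
    have ww: "w \<in> words"
      using \<tau>(1) w by simp
    have pow: "(\<tau> ^^ n) (v \<frown> c n \<frown> y) = v \<frown> y \<and> c n \<in> words" if "y \<in> X" for n y
    proof (induction n)
      case (Suc n)
      have "(\<tau> ^^ Suc n) (v \<frown> c (Suc n) \<frown> y) = (\<tau> ^^ n) (\<tau> (u \<frown> c n \<frown> y))"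
        by (simp add: funpow_swap1 c_def w)
      then show ?case
        using \<tau>(5)[of "c n \<frown> y"] that ww Suc by (simp add: c_def)
    qed (simp add: c_def)
    have "c p = []"
    proof (rule ccontr)
      assume "c p \<noteq> []"
      then obtain y where y: "y \<in> X" "c p \<frown> y \<noteq> y"
        by (rule ex_conc_neq)
      then show False
        using pow[OF y(1), of p] period[of "v \<frown> c p \<frown> y"] \<tau>(2) by simp
    qed
    then show ?thesis
      using w p_gt_1 by (simp add: c_def)
  qed
  then have "cyl u \<subseteq> Fix"
    using \<tau> by (auto simp: cyl_def fixed_points_def)
  moreover have "pref (length u) x = u"
    by (simp add: \<tau>(4))
  ultimately show "\<exists>n. cyl (pref n x) \<subseteq> Fix"
    by metis
qed (auto simp: fixed_points_def)

lemma clopen_fixed: "clopen Fix"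
proof -
  have "closedin T {x \<in> X. \<tau> x = id x}"
    by (rule closedin_continuous_maps_eq[OF Hausdorff_space_T])
      (use continuous_funpow[of 1] in simp_all)
  then show ?thesis
    using openin_fixed by (simp add: clopen_def fixed_points_def)
qed

lemma funpow_not_fixed: "x \<in> X - Fix \<Longrightarrow> (\<tau> ^^ n) x \<in> X - Fix"
proof -
  assume x: "x \<in> X - Fix"
  have "(\<tau> ^^ n) (\<tau> x) = \<tau> ((\<tau> ^^ n) x)"
    by (simp add: funpow_swap1)
  then have "\<tau> ((\<tau> ^^ n) x) \<noteq> (\<tau> ^^ n) x"
    using x inj_funpow[of "\<tau> x" x n] in_X by (auto simp: fixed_points_def)
  then show "(\<tau> ^^ n) x \<in> X - Fix"
    using x funpow_in_X by (simp add: fixed_points_def)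
qed

lemma funpow_neq_nbhd:
  assumes x: "x \<in> X - Fix" and j: "0 < j" "j < p"
  obtains n where "\<And>y. y \<in> cyl (pref n x) \<Longrightarrow> (\<tau> ^^ j) y \<notin> cyl (pref n x)"
proof -
  have xX: "x \<in> X" and fX: "(\<tau> ^^ j) x \<in> X"
    using x funpow_in_X by auto
  have "(\<tau> ^^ j) x \<noteq> x"
    using x j funpow_fixed by (auto simp: fixed_points_def)
  then obtain i where i: "(\<tau> ^^ j) x i \<noteq> x i"
    by blast
  let ?C = "cyl (pref (Suc i) ((\<tau> ^^ j) x))"
  have "openin T {y \<in> X. (\<tau> ^^ j) y \<in> ?C}"
    by (rule openin_continuous_map_preimage[OF continuous_funpow openin_cyl]) (use fX in simp)
  then obtain m where m: "cyl (pref m x) \<subseteq> {y \<in> X. (\<tau> ^^ j) y \<in> ?C}"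
    using xX fX unfolding openin_iff_cyl by (metis (no_types, lifting) in_cyl_pref mem_Collect_eq)
  \<comment> \<open>Depth \<open>m\<close> determines letter \<open>i\<close> of the image and depth
    \<open>Suc i\<close> determines letter \<open>i\<close> of the point. These letters differ, so
    the cylinder misses its image.\<close>
  define n where "n = max m (Suc i)"
  have "(\<tau> ^^ j) y \<notin> cyl (pref n x)" if "y \<in> cyl (pref n x)" for y
  proof -
    have "y \<in> cyl (pref m x)"
      using that cyl_pref_mono[OF xX, of m n] by (auto simp: n_def)
    then have "(\<tau> ^^ j) y i = (\<tau> ^^ j) x i"
      using m in_cyl_pref_iff[OF fX] by auto
    then show ?thesis
      using i in_cyl_pref_iff[OF xX, of _ n] by (metis n_def less_max_iff_disj lessI)
  qed
  then show thesis
    using that by blast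
qed

text \<open>The points of least height in their orbits will form a fundamental domain.\<close>

lemma separating_height:
  obtains h :: "(nat \<Rightarrow> nat) \<Rightarrow> nat" where "continuous_map T (discrete_topology UNIV) h"
    "\<And>x j. x \<in> X - Fix \<Longrightarrow> 0 < j \<Longrightarrow> j < p \<Longrightarrow> h ((\<tau> ^^ j) x) \<noteq> h x"
proof -
  \<comment> \<open>\<open>Q w\<close> says that the cylinder is disjoint from its proper
    translates; subcylinders inherit this.\<close>
  define Q where "Q = (\<lambda>w. \<forall>j\<in>{0<..<p}. \<forall>y\<in>cyl w. (\<tau> ^^ j) y \<notin> cyl w)"
  have "\<exists>n. Q (pref n x)" if x: "x \<in> X - Fix" for x
  proof -
    have "\<forall>j\<in>{0<..<p}. \<exists>n. \<forall>y\<in>cyl (pref n x). (\<tau> ^^ j) y \<notin> cyl (pref n x)"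
      using funpow_neq_nbhd[OF x] by (metis greaterThanLessThan_iff)
    then obtain m where m: "\<And>j y. j \<in> {0<..<p} \<Longrightarrow> y \<in> cyl (pref (m j) x) \<Longrightarrow> (\<tau> ^^ j) y \<notin> cyl (pref (m j) x)"
      by metis
    define n where "n = Max (m ` {0<..<p})"
    have "cyl (pref n x) \<subseteq> cyl (pref (m j) x)" if "j \<in> {0<..<p}" for j
      using x that by (intro cyl_pref_mono) (auto simp: n_def)
    then have "Q (pref n x)"
      unfolding Q_def using m by blast
    then show ?thesis ..
  qed
  moreover have "Q (u @ v)" if "Q u" "v \<in> words" for u v
    using that cyl_append_subset[of v u] unfolding Q_def by blast
  ultimately obtain S where S: "cylinder_partition S (X - Fix)" "\<And>w. w \<in> S \<Longrightarrow> Q w"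
    using clopen_refined_partition[OF clopen_Diff[OF clopen_X clopen_fixed], of Q] by blast
  have U: "X - Fix = \<Union> (cyl ` S)" and SW: "S \<subseteq> words" and "finite S"
    using S by (auto simp: cylinder_partition_def)
  then obtain e :: "nat list \<Rightarrow> nat" where e: "inj_on e S"
    using finite_imp_inj_to_nat_seg by blast
  \<comment> \<open>The height is the label of the cylinder containing the point. Two points of one
    orbit never share a cylinder, so their labels differ; the default 0 is used on the clopen fixed
    point set and preserves continuity.\<close>
  define h where "h = (\<lambda>x. if x \<in> X - Fix then e (THE w. w \<in> S \<and> x \<in> cyl w) else 0)"
  have h: "h x = e w" if "w \<in> S" "x \<in> cyl w" for w x
  proof -
    have "(THE w. w \<in> S \<and> x \<in> cyl w) = w"
      using that S(1) unfolding cylinder_partition_def disjoint_family_on_def by blast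
    moreover have "x \<in> X - Fix"
      using that U by blast
    ultimately show ?thesis
      by (simp add: h_def)
  qed
  have "\<exists>n. \<forall>y\<in>cyl (pref n x). h y = h x" if x: "x \<in> X" for x
  proof (cases "x \<in> Fix")
    case True
    then obtain n where "cyl (pref n x) \<subseteq> Fix"
      using openin_fixed unfolding openin_iff_cyl by blast
    then show ?thesis
      using True by (intro exI[of _ n]) (auto simp: h_def)
  next
    case False
    then obtain w where w: "w \<in> S" "x \<in> cyl w"
      using U x by blast
    then have "pref (length w) x = w"
      using in_cyl_iff SW by blast
    then have "\<forall>y\<in>cyl (pref (length w) x). h y = h x"
      using h[OF w(1)] w(2) by simp
    then show ?thesis ..
  qed
  then have "continuous_map T (discrete_topology UNIV) h"
    by (simp add: continuous_map_discrete_iff)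
  moreover have "h ((\<tau> ^^ j) x) \<noteq> h x" if x: "x \<in> X - Fix" and j: "0 < j" "j < p" for x j
  proof
    assume eq: "h ((\<tau> ^^ j) x) = h x"
    obtain w where w: "w \<in> S" "x \<in> cyl w"
      using U x by blast
    obtain w' where w': "w' \<in> S" "(\<tau> ^^ j) x \<in> cyl w'"
      using U funpow_not_fixed[OF x] by blast
    have "w = w'"
      using eq h[OF w] h[OF w'] w w' e by (auto dest: inj_onD)
    then show False
      using S(2)[OF w(1)] w w' j unfolding Q_def by auto
  qed
  ultimately show thesis
    by (rule that)
qed

text \<open>Outside the fixed points the heights along an orbit are pairwise distinct, so each orbit
  has exactly one lowest point. Being lowest is a finite conjunction of clopen conditions.\<close>

lemma fundamental_domain:
  obtains A where "clopen A" "bij_betw (\<lambda>(j, a). (\<tau> ^^ j) a) ({..<p} \<times> A) (X - Fix)"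
proof -
  obtain h :: "(nat \<Rightarrow> nat) \<Rightarrow> nat" where h: "continuous_map T (discrete_topology UNIV) h"
    "\<And>x j. x \<in> X - Fix \<Longrightarrow> 0 < j \<Longrightarrow> j < p \<Longrightarrow> h ((\<tau> ^^ j) x) \<noteq> h x"
    using separating_height by metis
  define A where "A = (X - Fix) \<inter> (\<Inter>j\<in>{0<..<p}. {x \<in> X. h x < h ((\<tau> ^^ j) x)})"
  have "continuous_map T (discrete_topology UNIV) (\<lambda>x. h ((\<tau> ^^ j) x))" for j
    using continuous_map_compose[OF continuous_funpow h(1), of j] by (simp add: o_def)
  then have "clopen A"
    unfolding A_def by (intro clopen_INT clopen_Diff clopen_X clopen_fixed clopen_less h(1)) auto
  have less: "h a < h ((\<tau> ^^ j) a)" if "a \<in> A" "0 < j" "j < p" for a j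
    using that by (auto simp: A_def)
  have AU: "A \<subseteq> X - Fix"
    by (auto simp: A_def)
  let ?f = "\<lambda>(j, a). (\<tau> ^^ j) a"
  \<comment> \<open>Two different points of \<open>A\<close> in one orbit would each be strictly
    lower than the other.\<close>
  have same: "b = a" if "a \<in> A" "b \<in> A" "b = (\<tau> ^^ k) a" for a b k
  proof (rule ccontr)
    assume neq: "b \<noteq> a"
    let ?k = "k mod p"
    have k: "b = (\<tau> ^^ ?k) a" "?k < p"
      using that AU p_gt_1 by (auto simp: funpow_mod)
    then have "0 < ?k"
      using neq by (metis bot_nat_0.not_eq_extremum funpow_0)
    moreover have "(\<tau> ^^ (p - ?k)) b = a"
      using k that(1) AU funpow_diff[of a ?k] by auto
    ultimately have "h a < h b" "h b < h a"
      using less[OF that(1), of ?k] less[OF that(2), of "p - ?k"] k by auto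
    then show False
      by simp
  qed
  have "inj_on ?f ({..<p} \<times> A)"
  proof -
    have "i = j \<and> a = b" if "i < p" "j < p" "i \<le> j" "a \<in> A" "b \<in> A" "(\<tau> ^^ i) a = (\<tau> ^^ j) b" for i j a b
    proof -
      have X: "a \<in> X" "b \<in> X" "b \<notin> Fix"
        using that AU by auto
      have "(\<tau> ^^ i) a = (\<tau> ^^ i) ((\<tau> ^^ (j - i)) b)"
        using that(3,6) by (metis comp_apply funpow_add le_add_diff_inverse)
      then have eq: "a = (\<tau> ^^ (j - i)) b"
        using inj_funpow[of a "(\<tau> ^^ (j - i)) b" i] X funpow_in_X by simp
      then have "a = b"
        using same that(4,5) by blast
      moreover from this have "i = j"
        using eq funpow_fixed[of b "j - i"] X that(1-3) unfolding fixed_points_def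
        by (metis (mono_tags, lifting) diff_is_0_eq' le_antisym less_imp_diff_less mem_Collect_eq not_le zero_less_diff)
      ultimately show ?thesis
        by simp
    qed
    then have "i = j \<and> a = b" if "i < p" "j < p" "a \<in> A" "b \<in> A" "(\<tau> ^^ i) a = (\<tau> ^^ j) b" for i j a b
      using that by (metis nat_le_linear)
    then show ?thesis
      by (auto simp: inj_on_def)
  qed
  moreover have "?f ` ({..<p} \<times> A) = X - Fix"
  proof (intro equalityI subsetI)
    fix x assume "x \<in> ?f ` ({..<p} \<times> A)"
    then show "x \<in> X - Fix"
      using AU funpow_not_fixed by auto
  next
    fix x assume x: "x \<in> X - Fix"
    define k where "k = arg_min_on (\<lambda>k. h ((\<tau> ^^ k) x)) {..<p}"
    have ne: "finite {..<p}" "{..<p} \<noteq> {}"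
      using p_gt_1 by auto
    have k: "k < p"
      using arg_min_if_finite(1)[OF ne] unfolding k_def by blast
    have min: "h ((\<tau> ^^ k) x) \<le> h ((\<tau> ^^ i) x)" if "i < p" for i
      unfolding k_def using arg_min_least[OF ne] that by simp
    let ?a = "(\<tau> ^^ k) x"
    have aU: "?a \<in> X - Fix"
      using x by (rule funpow_not_fixed)
    have "h ?a < h ((\<tau> ^^ j) ?a)" if j: "0 < j" "j < p" for j
    proof -
      have "(\<tau> ^^ j) ?a = (\<tau> ^^ ((j + k) mod p)) x"
        using x by (simp add: funpow_mod funpow_add)
      then have "h ?a \<le> h ((\<tau> ^^ j) ?a)"
        using min[of "(j + k) mod p"] p_gt_1 by simp
      then show ?thesis
        using h(2)[OF aU j] by simp
    qed
    then have "?a \<in> A"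
      using aU by (auto simp: A_def)
    \<comment> \<open>Reduction modulo \<open>p\<close> takes care of \<open>k = 0\<close>, where
      \<open>p - k\<close> falls outside the index range.\<close>
    moreover have "x = (\<tau> ^^ ((p - k) mod p)) ?a"
      using x k aU funpow_diff[of x k] by (simp add: funpow_mod)
    ultimately show "x \<in> ?f ` ({..<p} \<times> A)"
      using p_gt_1 by (intro image_eqI[of _ _ "((p - k) mod p, ?a)"]) auto
  qed
  ultimately show thesis
    using that \<open>clopen A\<close> by (simp add: bij_betw_def)
qed

lemma cylinder_count_fixed:
  assumes A: "clopen A" and bij: "bij_betw (\<lambda>(j, a). (\<tau> ^^ j) a) ({..<p} \<times> A) (X - Fix)"
  shows "[p * cylinder_count A + cylinder_count Fix = 1] (mod (N - 1))"
proof -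
  let ?f = "\<lambda>(j, a). (\<tau> ^^ j) a"
  have inj: "inj_on ?f ({..<p} \<times> A)" and img: "?f ` ({..<p} \<times> A) = X - Fix"
    using bij by (auto simp: bij_betw_def)
  have AX: "A \<subseteq> X"
    using A by (rule clopen_subset_X)
  have *: "clopen ((\<tau> ^^ j) ` A)" "cylinder_count ((\<tau> ^^ j) ` A) = cylinder_count A" for j
  proof -
    have "inj_on (\<tau> ^^ j) A"
      using inj_funpow AX by (meson inj_onI subsetD)
    then show "clopen ((\<tau> ^^ j) ` A)" "cylinder_count ((\<tau> ^^ j) ` A) = cylinder_count A"
      using locally_prefix_replacing_image[OF A, of "\<tau> ^^ j"] lpr_funpow AX by blast+
  qed
  have "disjoint_family_on (\<lambda>j. (\<tau> ^^ j) ` A) {..<p}"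
    unfolding disjoint_family_on_def
  proof (intro ballI impI equals0I)
    fix i j x assume ij: "i \<in> {..<p}" "j \<in> {..<p}" "i \<noteq> j" "x \<in> (\<tau> ^^ i) ` A \<inter> (\<tau> ^^ j) ` A"
    then obtain a b where "a \<in> A" "b \<in> A" "?f (i, a) = ?f (j, b)"
      by auto
    then show False
      using ij inj_onD[OF inj, of "(i, a)" "(j, b)"] by simp
  qed
  then have "cylinder_count (\<Union>j<p. (\<tau> ^^ j) ` A) = (p * cylinder_count A) mod (N - 1)"
    using cylinder_count_UN[of "{..<p}" "\<lambda>j. (\<tau> ^^ j) ` A"] * by simp
  moreover have "(\<Union>j<p. (\<tau> ^^ j) ` A) = X - Fix"
    unfolding img[symmetric] by force
  moreover have "cylinder_count ((X - Fix) \<union> Fix) = (cylinder_count (X - Fix) + cylinder_count Fix) mod (N - 1)"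
    using clopen_Diff[OF clopen_X clopen_fixed] clopen_fixed by (intro cylinder_count_Un) auto
  moreover have "(X - Fix) \<union> Fix = X"
    using clopen_subset_X[OF clopen_fixed] by blast
  moreover have "cylinder_count X = 1 mod (N - 1)"
    using cylinder_count_eq[OF cylinder_partition_X] by simp
  ultimately show ?thesis
    by (simp add: cong_def mod_add_left_eq)
qed


end

section \<open>Constructing conjugators and elements of prime order\<close>

context full_shift
begin

text \<open>Equal counts of the fixed points give equal counts of the fundamental domains, because
  \<open>p\<close> cancels modulo \<open>N - 1\<close>. A matching of the domains extends
  equivariantly along the orbits, and any matching of the fixed point sets completes it.\<close>

lemma prime_period_conjugator:
  assumes "prime_period N \<tau> p" "prime_period N \<tau>' p" and coprime: "coprime p (N - 1)"
    and count: "cylinder_count (fixed_points X \<tau>) = cylinder_count (fixed_points X \<tau>')"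
    and empty: "fixed_points X \<tau> = {} \<longleftrightarrow> fixed_points X \<tau>' = {}"
    and ne: "fixed_points X \<tau> \<noteq> X" "fixed_points X \<tau>' \<noteq> X"
  obtains g where "bij_betw g X X" "\<And>x. x \<in> X \<Longrightarrow> locally_prefix_replacing g x"
    "\<And>x. x \<in> X \<Longrightarrow> g (\<tau> x) = \<tau>' (g x)"
proof -
  interpret t: prime_period N \<tau> p by fact
  interpret t': prime_period N \<tau>' p by fact
  let ?f = "\<lambda>(j, a). (\<tau> ^^ j) a" and ?f' = "\<lambda>(j, a). (\<tau>' ^^ j) a"
  obtain A where A: "clopen A" "bij_betw ?f ({..<p} \<times> A) (X - t.Fix)"
    using t.fundamental_domain by blast
  obtain A' where A': "clopen A'" "bij_betw ?f' ({..<p} \<times> A') (X - t'.Fix)"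
    using t'.fundamental_domain by blast
  have FX: "t.Fix \<subseteq> X" "t'.Fix \<subseteq> X"
    by (auto simp: fixed_points_def)
  have AX: "A \<subseteq> X"
    using A(1) by (rule clopen_subset_X)
  have "A \<noteq> {}" "A' \<noteq> {}"
    using A(2) A'(2) ne FX by (auto simp: bij_betw_def)
  have "[p * cylinder_count A + cylinder_count t.Fix = p * cylinder_count A' + cylinder_count t.Fix] (mod (N - 1))"
    using t.cylinder_count_fixed[OF A] t'.cylinder_count_fixed[OF A', folded count]
    by (rule cong_trans[OF _ cong_sym])
  then have "[cylinder_count A = cylinder_count A'] (mod (N - 1))"
    unfolding cong_add_rcancel_nat cong_mult_lcancel_nat[OF coprime] .
  then have "cylinder_count A = cylinder_count A'"
    by (simp add: cong_def cylinder_count_def)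
  then obtain h where h: "bij_betw h A A'" "\<And>x. x \<in> A \<Longrightarrow> locally_prefix_replacing h x"
    using cylinder_count_eq_imp_bij[OF A(1) A'(1)] \<open>A \<noteq> {}\<close> \<open>A' \<noteq> {}\<close> by blast
  obtain h0 where h0: "bij_betw h0 t.Fix t'.Fix" "\<And>x. x \<in> t.Fix \<Longrightarrow> locally_prefix_replacing h0 x"
    using cylinder_count_eq_imp_bij[OF t.clopen_fixed t'.clopen_fixed count empty] by blast
  \<comment> \<open>A point is written as \<open>(\<tau> ^^ j) a\<close> with \<open>a\<close> in
    \<open>A\<close> and sent to \<open>(\<tau>' ^^ j) (h a)\<close>.\<close>
  define k where "k = (\<lambda>x. ?f' (map_prod id h (inv_into ({..<p} \<times> A) ?f x)))"
  define g where "g = (\<lambda>x. if x \<in> t.Fix then h0 x else k x)"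
  have k_bij: "bij_betw k (X - t.Fix) (X - t'.Fix)"
  proof -
    have "bij_betw (map_prod id h) ({..<p} \<times> A) ({..<p} \<times> A')"
      using h(1) by (intro bij_betw_map_prod) auto
    then have "bij_betw (?f' \<circ> (map_prod id h \<circ> inv_into ({..<p} \<times> A) ?f)) (X - t.Fix) (X - t'.Fix)"
      using A'(2) bij_betw_inv_into[OF A(2)] by (blast intro: bij_betw_trans)
    then show ?thesis
      by (simp add: k_def o_def)
  qed
  have g_bij: "bij_betw g X X"
  proof -
    have "bij_betw g t.Fix t'.Fix"
      using h0(1) by (rule bij_betw_cong[THEN iffD1, rotated]) (simp add: g_def)
    moreover have "bij_betw g (X - t.Fix) (X - t'.Fix)"
      using k_bij by (rule bij_betw_cong[THEN iffD1, rotated]) (simp add: g_def)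
    ultimately have "bij_betw g (t.Fix \<union> (X - t.Fix)) (t'.Fix \<union> (X - t'.Fix))"
      by (rule bij_betw_combine) blast
    then show ?thesis
      using FX by (simp add: Un_absorb1)
  qed
  have gk: "g ((\<tau> ^^ j) a) = (\<tau>' ^^ j) (h a)" if j: "j < p" and a: "a \<in> A" for j a
  proof -
    have "inv_into ({..<p} \<times> A) ?f (?f (j, a)) = (j, a)"
      using A(2) j a by (intro inv_into_f_f) (auto simp: bij_betw_def)
    then have "k ((\<tau> ^^ j) a) = (\<tau>' ^^ j) (h a)"
      by (simp add: k_def)
    moreover have "?f (j, a) \<in> X - t.Fix"
      using A(2) j a by (intro bij_betw_apply[OF A(2)]) auto
    ultimately show ?thesis
      by (simp add: g_def)
  qed
  have decomp: "\<exists>j<p. \<exists>a\<in>A. x = (\<tau> ^^ j) a" if "x \<in> X - t.Fix" for x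
  proof -
    have "x \<in> ?f ` ({..<p} \<times> A)"
      using A(2) that by (simp add: bij_betw_def)
    then show ?thesis
      by auto
  qed
  have hX: "h a \<in> X" if "a \<in> A" for a
    using h(1) that clopen_subset_X[OF A'(1)] by (auto simp: bij_betw_def)
  have "locally_prefix_replacing g x" if x: "x \<in> X" for x
  proof (cases "x \<in> t.Fix")
    case True
    show ?thesis
      by (rule locally_prefix_replacing_cong[OF t.openin_fixed True _ h0(2)[OF True]]) (simp add: g_def)
  next
    case False
    then obtain j a where ja: "j < p" "a \<in> A" "x = (\<tau> ^^ j) a"
      using decomp x by blast
    let ?\<sigma> = "\<tau> ^^ (p - j)"
    have \<sigma>: "?\<sigma> ((\<tau> ^^ j) b) = b" if "b \<in> A" for b
      using t.funpow_diff[of b j] AX that ja(1) by auto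
    \<comment> \<open>On the translate containing \<open>x\<close> the map \<open>g\<close> goes
      back to \<open>A\<close>, crosses by \<open>h\<close>, and moves forward again, so it is a
      composite of prefix replacements.\<close>
    have "locally_prefix_replacing ((\<tau>' ^^ j) \<circ> (h \<circ> ?\<sigma>)) x"
    proof (intro locally_prefix_replacing_comp)
      show "locally_prefix_replacing ?\<sigma> x"
        using x by (rule t.lpr_funpow)
      show "locally_prefix_replacing h (?\<sigma> x)"
        using h(2)[OF ja(2)] \<sigma>[OF ja(2)] ja(3) by simp
      show "locally_prefix_replacing (\<tau>' ^^ j) ((h \<circ> ?\<sigma>) x)"
        using t'.lpr_funpow[OF hX[OF ja(2)]] \<sigma>[OF ja(2)] ja(3) by simp
    qed
    moreover have "openin T ((\<tau> ^^ j) ` A)"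
    proof -
      have "inj_on (\<tau> ^^ j) A"
        using t.inj_funpow AX by (meson inj_onI subsetD)
      then show ?thesis
        using locally_prefix_replacing_image(1)[OF A(1), of "\<tau> ^^ j"] t.lpr_funpow AX
        unfolding clopen_def by blast
    qed
    ultimately show ?thesis
    proof (rule locally_prefix_replacing_cong[rotated -1])
      show "x \<in> (\<tau> ^^ j) ` A"
        using ja by blast
      show "g y = ((\<tau>' ^^ j) \<circ> (h \<circ> ?\<sigma>)) y" if "y \<in> (\<tau> ^^ j) ` A" for y
        using that gk[OF ja(1)] \<sigma> by auto
    qed
  qed
  moreover have "g (\<tau> x) = \<tau>' (g x)" if x: "x \<in> X" for x
  proof (cases "x \<in> t.Fix")
    case True
    then have "h0 x \<in> t'.Fix"
      using h0(1) by (auto simp: bij_betw_def)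
    then show ?thesis
      using True by (simp add: g_def fixed_points_def)
  next
    case False
    then obtain j a where ja: "j < p" "a \<in> A" "x = (\<tau> ^^ j) a"
      using decomp x by blast
    show ?thesis
    proof (cases "Suc j < p")
      case True
      then show ?thesis
        using gk[OF True ja(2)] gk[OF ja(1,2)] ja(3) by simp
    next
      case False
      \<comment> \<open>The wrap-around case: from the last translate \<open>\<tau>\<close> returns
        to \<open>A\<close>, and \<open>\<tau>'\<close> returns to \<open>A'\<close>.\<close>
      then have p: "p = Suc j"
        using ja(1) by simp
      have "\<tau> x = a"
        using t.period[of a] ja(2,3) AX p by auto
      moreover have "\<tau>' ((\<tau>' ^^ j) (h a)) = h a"
        using t'.period[OF hX[OF ja(2)]] p by simp
      ultimately show ?thesis
        using gk[of 0 a] gk[OF ja(1,2)] ja p by simp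
    qed
  qed
  ultimately show thesis
    using that g_bij by blast
qed

text \<open>The map shifts the first \<open>p * r\<close> cylinders of a partition cyclically by \<open>r\<close> and fixes the other \<open>f\<close>.\<close>

lemma prime_period_exists:
  assumes p: "prime p" and r: "r > 0" and cong: "[p * r + f = 1] (mod (N - 1))"
  obtains \<tau> where "prime_period N \<tau> p" "fixed_points X \<tau> \<noteq> X"
    "cylinder_count (fixed_points X \<tau>) = f mod (N - 1)" "fixed_points X \<tau> = {} \<longleftrightarrow> f = 0"
proof -
  define m where "m = p * r"
  have p1: "p > 1"
    using p by (rule prime_gt_1_nat)
  have m: "r < m" "0 < m"
    using p1 r by (simp_all add: m_def)
  have "(N - 1) dvd (m + f - 1)"
  proof -
    have "1 \<le> m + f"
      using m by simp
    then show ?thesis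
      using cong cong_altdef_nat unfolding m_def by blast
  qed
  \<comment> \<open>The congruence says that \<open>t\<close> splittings of the single cylinder
    \<open>X\<close> produce exactly \<open>m + f\<close> cylinders.\<close>
  then obtain t where "m + f - 1 = (N - 1) * t"
    by (elim dvdE)
  then have t: "m + f = card {[] :: nat list} + t * (N - 1)"
    using m by (simp add: mult.commute)
  obtain S where S: "cylinder_partition S X" "card S = m + f"
    using cylinder_partition_grow[OF cylinder_partition_X, of t] unfolding t by blast
  have SW: "S \<subseteq> words" and "finite S" and SX: "X = \<Union> (cyl ` S)" and dS: "disjoint_family_on cyl S"
    using S by (auto simp: cylinder_partition_def)
  then obtain e where e: "bij_betw e {0..<m + f} S"
    using ex_bij_betw_nat_finite[of S] S(2) by auto
  have einj: "e i = e j \<longleftrightarrow> i = j" if "i < m + f" "j < m + f" for i j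
    using inj_on_eq_iff[OF bij_betw_imp_inj_on[OF e]] that by simp
  have eS: "e i \<in> S" if "i < m + f" for i
    using bij_betwE[OF e] that by simp
  \<comment> \<open>Adding \<open>r\<close> modulo \<open>m = p * r\<close> has period
    \<open>p\<close>, and as \<open>0 < r < m\<close> it moves every index below
    \<open>m\<close>.\<close>
  define q where "q = (\<lambda>i. if i < m then (i + r) mod m else i)"
  have q_lt: "q i < m + f" if "i < m + f" for i
    using that m by (simp add: q_def trans_less_add1)
  have q_pow: "(q ^^ n) i = (if i < m then (i + n * r) mod m else i)" for n i
  proof (induction n)
    case (Suc n)
    have "((i + n * r) mod m + r) mod m = (i + Suc n * r) mod m"
      by (subst mod_add_left_eq) (simp add: algebra_simps)
    then show ?case
      using Suc m by (simp add: q_def)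
  qed (use m in simp)
  have q_p: "(q ^^ p) i = i" for i
    by (simp add: q_pow m_def[symmetric])
  have q_neq: "q i \<noteq> i" if "i < m" for i
  proof
    assume "q i = i"
    then have "(i + r) mod m = (i + 0) mod m"
      using that by (simp add: q_def)
    then have "r mod m = 0 mod m"
      using cong_add_lcancel_nat[of i r 0 m] by (simp add: cong_def)
    then show False
      using r m by simp
  qed
  have "inj q"
  proof (rule injI)
    fix a b assume "q a = q b"
    then have "(q ^^ (p - 1)) (q a) = (q ^^ (p - 1)) (q b)"
      by simp
    moreover have "(q ^^ (p - 1)) (q i) = (q ^^ p) i" for i
      using p1 funpow_Suc_right[of "p - 1" q] by simp
    ultimately show "a = b"
      by (simp add: q_p)
  qed
  then have "inj_on q {0..<m + f}"
    by (rule inj_on_subset) simp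
  moreover from this have "q ` {0..<m + f} = {0..<m + f}"
    using q_lt by (intro endo_inj_surj) auto
  ultimately have "bij_betw q {0..<m + f} {0..<m + f}"
    by (simp add: bij_betw_def)
  \<comment> \<open>The permutation of indices is transported to the words of
    \<open>S\<close>.\<close>
  then have "bij_betw (e \<circ> (q \<circ> inv_into {0..<m + f} e)) S S"
    using e bij_betw_inv_into[OF e] by (blast intro: bij_betw_trans)
  from cylinder_partition_bij_map[OF S(1) S(1) this] obtain \<tau> where \<tau>: "bij_betw \<tau> X X"
    "\<And>w y. w \<in> S \<Longrightarrow> y \<in> X \<Longrightarrow> \<tau> (w \<frown> y) = e (q (inv_into {0..<m + f} e w)) \<frown> y"
    "\<And>x. x \<in> X \<Longrightarrow> locally_prefix_replacing \<tau> x"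
    unfolding o_def by blast
  have \<tau>e: "\<tau> (e i \<frown> y) = e (q i) \<frown> y" if "i < m + f" "y \<in> X" for i y
    using \<tau>(2)[OF eS[OF that(1)] that(2)] e that(1) by (simp add: bij_betw_def inv_into_f_f)
  have \<tau>_pow: "(\<tau> ^^ n) (e i \<frown> y) = e ((q ^^ n) i) \<frown> y \<and> (q ^^ n) i < m + f" if "i < m + f" "y \<in> X" for n i y
    using that by (induction n) (simp_all add: \<tau>e q_lt)
  have decomp: "\<exists>i<m + f. \<exists>y\<in>X. x = e i \<frown> y" if "x \<in> X" for x
  proof -
    obtain w where "w \<in> S" "x \<in> cyl w"
      using SX \<open>x \<in> X\<close> by blast
    moreover from this obtain i where "i < m + f" "w = e i"
      using e by (auto simp: bij_betw_def)
    ultimately show ?thesis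
      unfolding cyl_def by blast
  qed
  have "prime_period N \<tau> p"
  proof unfold_locales
    fix x assume x: "x \<in> X"
    show "\<tau> x \<in> X"
      using \<tau>(1) x by (auto simp: bij_betw_def)
    show "locally_prefix_replacing \<tau> x"
      using x by (rule \<tau>(3))
    obtain i y where "i < m + f" "y \<in> X" "x = e i \<frown> y"
      using decomp[OF x] by blast
    then show "(\<tau> ^^ p) x = x"
      using \<tau>_pow[of i y p] q_p[of i] by simp
  qed (rule p)
  moreover have fix_iff: "e i \<frown> y \<in> fixed_points X \<tau> \<longleftrightarrow> m \<le> i" if i: "i < m + f" and y: "y \<in> X" for i y
  proof -
    have "e i \<frown> y \<in> X"
      using eS[OF i] SW y by auto
    have "\<tau> (e i \<frown> y) = e i \<frown> y \<longleftrightarrow> q i = i"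
    proof
      assume *: "\<tau> (e i \<frown> y) = e i \<frown> y"
      then have "cyl (e (q i)) \<inter> cyl (e i) \<noteq> {}"
        using conc_in_cyl[OF y, of "e i"] conc_in_cyl[OF y, of "e (q i)"] \<tau>e[OF i y] by auto
      then have "e (q i) = e i"
        using dS eS[OF i] eS[OF q_lt[OF i]] unfolding disjoint_family_on_def by blast
      then show "q i = i"
        using einj[OF q_lt[OF i] i] by simp
    qed (simp add: \<tau>e[OF i y])
    then show ?thesis
      using q_neq[of i] \<open>e i \<frown> y \<in> X\<close> by (auto simp: fixed_points_def q_def)
  qed
  moreover have fp: "cylinder_partition (e ` {m..<m + f}) (fixed_points X \<tau>)"
  proof -
    have sub: "e ` {m..<m + f} \<subseteq> S"
      using eS by auto
    have "fixed_points X \<tau> = \<Union> (cyl ` e ` {m..<m + f})"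
    proof (intro equalityI subsetI)
      fix x assume x: "x \<in> fixed_points X \<tau>"
      then obtain i y where "i < m + f" "y \<in> X" "x = e i \<frown> y"
        using decomp[of x] by (auto simp: fixed_points_def)
      then show "x \<in> \<Union> (cyl ` e ` {m..<m + f})"
        using x fix_iff[of i y] conc_in_cyl[of y "e i"] by (auto intro!: bexI[of _ i])
    next
      fix x assume "x \<in> \<Union> (cyl ` e ` {m..<m + f})"
      then obtain i y where "i < m + f" "m \<le> i" "y \<in> X" "x = e i \<frown> y"
        by (auto simp: cyl_def)
      then show "x \<in> fixed_points X \<tau>"
        using fix_iff by blast
    qed
    moreover have "disjoint_family_on cyl (e ` {m..<m + f})"
      using dS sub by (rule disjoint_family_on_mono[rotated])
    ultimately show ?thesis
      using sub SW by (auto simp: cylinder_partition_def)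
  qed
  have "card (e ` {m..<m + f}) = f"
    using e by (subst card_image) (auto simp: bij_betw_def elim: inj_on_subset)
  then have "cylinder_count (fixed_points X \<tau>) = f mod (N - 1)"
    using cylinder_count_eq[OF fp] by simp
  moreover have "fixed_points X \<tau> = {} \<longleftrightarrow> f = 0"
    using cylinder_partition_empty_iff[OF fp] by auto
  moreover have "fixed_points X \<tau> \<noteq> X"
  proof -
    obtain y where y: "y \<in> X"
      using X_nonempty by blast
    then have "e 0 \<frown> y \<in> X" "e 0 \<frown> y \<notin> fixed_points X \<tau>"
      using fix_iff[of 0 y] eS[of 0] SW m by auto
    then show ?thesis
      by blast
  qed
  ultimately show thesis
    using that by blast
qed

end

section \<open>Conjugacy classes of elements of prime order\<close>

text \<open>For prime \<open>p\<close> these are the elements of order exactly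
  \<open>p\<close>.\<close>

definition torsion :: "('a, 'b) monoid_scheme \<Rightarrow> nat \<Rightarrow> 'a set"
  where "torsion G p = {x \<in> carrier G. x \<noteq> \<one>\<^bsub>G\<^esub> \<and> x [^]\<^bsub>G\<^esub> p = \<one>\<^bsub>G\<^esub>}"

text \<open>Conjugacy multiplied out, so that no inverse occurs and an isomorphism transports it
  factor by factor.\<close>

definition conjugate :: "('a, 'b) monoid_scheme \<Rightarrow> 'a \<Rightarrow> 'a \<Rightarrow> bool"
  where "conjugate G x y \<longleftrightarrow> (\<exists>g\<in>carrier G. g \<otimes>\<^bsub>G\<^esub> x = y \<otimes>\<^bsub>G\<^esub> g)"

lemma iso_torsion:
  assumes "group G" "group H" and \<phi>: "\<phi> \<in> iso G H"
  shows "\<phi> ` torsion G p = torsion H p"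
proof -
  interpret group_hom G H \<phi>
    using assms by (simp add: group_hom_def group_hom_axioms_def iso_imp_homomorphism)
  have bij: "inj_on \<phi> (carrier G)" "\<phi> ` carrier G = carrier H"
    using \<phi> by (auto simp: iso_def bij_betw_def)
  have eq: "\<phi> x = \<one>\<^bsub>H\<^esub> \<longleftrightarrow> x = \<one>\<^bsub>G\<^esub>" if "x \<in> carrier G" for x
    using inj_on_eq_iff[OF bij(1) that G.one_closed] by simp
  have "\<phi> x \<in> torsion H p \<longleftrightarrow> x \<in> torsion G p" if "x \<in> carrier G" for x
    using that eq[OF that] eq[of "x [^]\<^bsub>G\<^esub> p"] by (simp add: torsion_def hom_nat_pow)
  moreover have "torsion G p \<subseteq> carrier G" "torsion H p \<subseteq> \<phi> ` carrier G"
    using bij(2) by (auto simp: torsion_def)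
  ultimately show ?thesis
    by blast
qed

lemma iso_conjugate_iff:
  assumes \<phi>: "\<phi> \<in> iso G H" and G: "group G" and xy: "x \<in> carrier G" "y \<in> carrier G"
  shows "conjugate H (\<phi> x) (\<phi> y) \<longleftrightarrow> conjugate G x y"
proof -
  interpret group G by fact
  have bij: "inj_on \<phi> (carrier G)" "carrier H = \<phi> ` carrier G"
    using \<phi> by (auto simp: iso_def bij_betw_def)
  have "\<phi> g \<otimes>\<^bsub>H\<^esub> \<phi> x = \<phi> y \<otimes>\<^bsub>H\<^esub> \<phi> g \<longleftrightarrow> g \<otimes>\<^bsub>G\<^esub> x = y \<otimes>\<^bsub>G\<^esub> g" if g: "g \<in> carrier G" for g
  proof -
    have "\<phi> (g \<otimes>\<^bsub>G\<^esub> x) = \<phi> g \<otimes>\<^bsub>H\<^esub> \<phi> x" "\<phi> (y \<otimes>\<^bsub>G\<^esub> g) = \<phi> y \<otimes>\<^bsub>H\<^esub> \<phi> g"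
      using \<phi> g xy by (auto simp: iso_def hom_def)
    then show ?thesis
      using inj_on_eq_iff[OF bij(1), of "g \<otimes>\<^bsub>G\<^esub> x" "y \<otimes>\<^bsub>G\<^esub> g"] g xy by simp
  qed
  then show ?thesis
    by (simp add: conjugate_def bij(2))
qed

text \<open>Both images are copies of the quotient of \<open>E\<close> by one equivalence relation.
  With this, conjugacy classes are counted through invariants, without forming the classes
  themselves.\<close>

lemma card_image_eq_if_same_kernel:
  assumes "\<And>x y. x \<in> E \<Longrightarrow> y \<in> E \<Longrightarrow> f x = f y \<longleftrightarrow> g x = g y"
  shows "card (f ` E) = card (g ` E)"
proof -
  define h where "h = (\<lambda>a. g (inv_into E f a))"
  have h: "h (f x) = g x" if "x \<in> E" for x
    unfolding h_def using that assms[of "inv_into E f (f x)" x]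
    by (simp add: inv_into_into f_inv_into_f)
  have "inj_on h (f ` E)"
    using h assms by (auto simp: inj_on_def)
  moreover have "h ` f ` E = g ` E"
    using h by (force simp: image_image)
  ultimately show ?thesis
    by (metis card_image)
qed

section \<open>Classification of torsion in the full group\<close>

context full_shift
begin

abbreviation "G \<equiv> continuous_full_group N"

lemma carrier_G: "carrier G = continuous_full_group_carrier N"
  by (simp add: continuous_full_group_def)

lemma one_G: "\<one>\<^bsub>G\<^esub> = restrict (\<lambda>x. x) X"
  by (simp add: continuous_full_group_def BijGroup_def)

lemma carrier_in_X: "\<tau> \<in> carrier G \<Longrightarrow> x \<in> X \<Longrightarrow> \<tau> x \<in> X"
  using carrier_bij_betw bij_betwE unfolding carrier_G by blast

lemma carrier_extensional: "\<tau> \<in> carrier G \<Longrightarrow> \<tau> \<in> extensional X"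
  by (simp add: carrier_G continuous_full_group_carrier_def)

lemma carrier_subset_Bij: "carrier G \<subseteq> Bij X"
  using carrier_bij_betw carrier_extensional carrier_G unfolding Bij_def by blast

lemma mult_G:
  assumes "\<sigma> \<in> carrier G" "\<tau> \<in> carrier G"
  shows "\<sigma> \<otimes>\<^bsub>G\<^esub> \<tau> = compose X \<sigma> \<tau>"
proof -
  have "\<sigma> \<in> Bij X" "\<tau> \<in> Bij X"
    using assms carrier_subset_Bij by blast+
  then show ?thesis
    by (simp add: continuous_full_group_def BijGroup_def)
qed

lemma pow_G:
  assumes \<tau>: "\<tau> \<in> carrier G"
  shows "\<tau> [^]\<^bsub>G\<^esub> (n :: nat) = restrict (\<tau> ^^ n) X"
proof (induction n)
  case 0
  have "\<tau> [^]\<^bsub>G\<^esub> (0 :: nat) = \<one>\<^bsub>G\<^esub>"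
    by (simp add: nat_pow_def)
  then show ?case
    by (simp add: one_G id_def)
next
  case (Suc n)
  have "\<tau> [^]\<^bsub>G\<^esub> n \<in> carrier G"
    by (rule monoid.nat_pow_closed[OF group.is_monoid[OF group_continuous_full_group] \<tau>])
  then have "\<tau> [^]\<^bsub>G\<^esub> n \<otimes>\<^bsub>G\<^esub> \<tau> = compose X (\<tau> [^]\<^bsub>G\<^esub> n) \<tau>"
    using \<tau> by (rule mult_G)
  then have "\<tau> [^]\<^bsub>G\<^esub> Suc n = compose X (restrict (\<tau> ^^ n) X) \<tau>"
    by (simp only: Suc.IH[symmetric] nat_pow_def nat.rec)
  also have "\<dots> = restrict (\<tau> ^^ Suc n) X"
  proof
    fix x
    show "compose X (restrict (\<tau> ^^ n) X) \<tau> x = restrict (\<tau> ^^ Suc n) X x"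
      using carrier_in_X[OF \<tau>, of x]
      by (cases "x \<in> X") (simp_all add: compose_def funpow_swap1)
  qed
  finally show ?case .
qed

lemma torsion_prime_period:
  assumes "prime p" "\<tau> \<in> torsion G p"
  shows "prime_period N \<tau> p" "fixed_points X \<tau> \<noteq> X"
proof -
  have \<tau>: "\<tau> \<in> carrier G" "\<tau> \<noteq> \<one>\<^bsub>G\<^esub>" "\<tau> [^]\<^bsub>G\<^esub> p = \<one>\<^bsub>G\<^esub>"
    using assms(2) by (auto simp: torsion_def)
  show "prime_period N \<tau> p"
  proof unfold_locales
    fix x assume x: "x \<in> X"
    show "\<tau> x \<in> X"
      using \<tau>(1) x by (rule carrier_in_X)
    show "locally_prefix_replacing \<tau> x"
      using \<tau>(1) x carrier_locally_prefix_replacing by (simp add: carrier_G)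
    have "restrict (\<tau> ^^ p) X x = restrict (\<lambda>x. x) X x"
      using \<tau>(3) by (simp only: pow_G[OF \<tau>(1)] one_G)
    then show "(\<tau> ^^ p) x = x"
      using x by simp
  qed (rule assms(1))
  show "fixed_points X \<tau> \<noteq> X"
  proof
    assume "fixed_points X \<tau> = X"
    then have "\<tau> x = x" if "x \<in> X" for x
      using that by (auto simp: fixed_points_def)
    then have "\<tau> = restrict (\<lambda>x. x) X"
      using carrier_extensional[OF \<tau>(1)] by (auto intro!: extensionalityI[of _ X])
    then show False
      using \<tau>(2) by (simp add: one_G)
  qed
qed

lemma restrict_in_carrier:
  assumes "bij_betw g X X" "\<And>x. x \<in> X \<Longrightarrow> locally_prefix_replacing g x"
  shows "restrict g X \<in> carrier G"
  unfolding carrier_G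
proof (rule locally_prefix_replacing_in_carrier)
  show "bij_betw (restrict g X) X X"
    using assms(1) by (rule bij_betw_cong[THEN iffD1, rotated]) simp
  show "locally_prefix_replacing (restrict g X) x" if "x \<in> X" for x
    by (rule locally_prefix_replacing_cong[OF openin_topspace that _ assms(2)[OF that]]) simp
qed simp

lemma prime_period_torsion:
  assumes "prime_period N \<tau> p" "fixed_points X \<tau> \<noteq> X"
  shows "restrict \<tau> X \<in> torsion G p"
proof -
  interpret t: prime_period N \<tau> p by fact
  \<comment> \<open>This power is the inverse of \<open>\<tau>\<close> on \<open>X\<close>, which
    provides bijectivity.\<close>
  let ?\<sigma> = "\<tau> ^^ (p - 1)"
  have "\<tau> (?\<sigma> x) = x" "?\<sigma> (\<tau> x) = x" if "x \<in> X" for x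
  proof -
    have "\<tau> ^^ p = \<tau> \<circ> ?\<sigma>" "\<tau> ^^ p = ?\<sigma> \<circ> \<tau>"
      using t.p_gt_1 funpow.simps(2)[of "p - 1" \<tau>] funpow_Suc_right[of "p - 1" \<tau>] by simp_all
    then show "\<tau> (?\<sigma> x) = x" "?\<sigma> (\<tau> x) = x"
      using t.period[OF that] by (metis comp_apply)+
  qed
  then have "bij_betw \<tau> X X"
    by (intro bij_betw_byWitness[of X ?\<sigma>]) (auto simp: t.in_X t.funpow_in_X)
  then have carrier: "restrict \<tau> X \<in> carrier G"
    using t.lpr by (rule restrict_in_carrier)
  have "(restrict \<tau> X ^^ n) x = (\<tau> ^^ n) x" if "x \<in> X" for n x
    using that by (induction n) (simp_all add: t.funpow_in_X)
  then have "restrict \<tau> X [^]\<^bsub>G\<^esub> p = \<one>\<^bsub>G\<^esub>"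
    unfolding pow_G[OF carrier] one_G using t.period by (intro restrict_ext) simp
  moreover have "restrict \<tau> X \<noteq> \<one>\<^bsub>G\<^esub>"
  proof
    assume "restrict \<tau> X = \<one>\<^bsub>G\<^esub>"
    then have "\<tau> x = x" if "x \<in> X" for x
      using that unfolding one_G by (metis restrict_apply')
    then show False
      using assms(2) by (auto simp: fixed_points_def)
  qed
  ultimately show ?thesis
    using carrier by (simp add: torsion_def)
qed

text \<open>The flag separates the empty set from nonempty sets whose number of cylinders is a
  multiple of \<open>N - 1\<close>, as both have count 0.\<close>

definition fixed_point_type :: "((nat \<Rightarrow> nat) \<Rightarrow> (nat \<Rightarrow> nat)) \<Rightarrow> nat \<times> bool"
  where "fixed_point_type \<tau> = (cylinder_count (fixed_points X \<tau>), fixed_points X \<tau> = {})"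

text \<open>A conjugator carries fixed points onto fixed points and preserves counts; conversely
  equal types are the hypotheses of \<open>prime_period_conjugator\<close>.\<close>

lemma conjugate_iff_fixed_point_type:
  assumes p: "prime p" "coprime p (N - 1)" and \<sigma>: "\<sigma> \<in> torsion G p" and \<tau>: "\<tau> \<in> torsion G p"
  shows "conjugate G \<sigma> \<tau> \<longleftrightarrow> fixed_point_type \<sigma> = fixed_point_type \<tau>"
proof
  interpret s: prime_period N \<sigma> p
    using p(1) \<sigma> by (rule torsion_prime_period)
  interpret t: prime_period N \<tau> p
    using p(1) \<tau> by (rule torsion_prime_period)
  have carrier: "\<sigma> \<in> carrier G" "\<tau> \<in> carrier G"
    using \<sigma> \<tau> by (auto simp: torsion_def)
  {
    assume "conjugate G \<sigma> \<tau>"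
    then obtain g where g: "g \<in> carrier G" "compose X g \<sigma> = compose X \<tau> g"
      using carrier by (auto simp: conjugate_def mult_G)
    have bij: "bij_betw g X X"
      using g(1) by (simp add: carrier_G carrier_bij_betw)
    have comm: "g (\<sigma> x) = \<tau> (g x)" if "x \<in> X" for x
      using fun_cong[OF g(2), of x] that by (simp add: compose_def)
    have img: "g ` s.Fix = t.Fix"
    proof (intro equalityI subsetI)
      fix y assume "y \<in> g ` s.Fix"
      then obtain x where "x \<in> X" "\<sigma> x = x" "y = g x"
        by (auto simp: fixed_points_def)
      then show "y \<in> t.Fix"
        using comm[of x] carrier_in_X[OF g(1)] by (simp add: fixed_points_def)
    next
      fix y assume y: "y \<in> t.Fix"
      then obtain x where x: "x \<in> X" "y = g x"
        using bij by (auto simp: bij_betw_def fixed_points_def)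
      then have "g (\<sigma> x) = g x"
        using comm[of x] y by (simp add: fixed_points_def)
      then have "\<sigma> x = x"
        using bij x(1) s.in_X by (auto simp: bij_betw_def dest: inj_onD)
      then show "y \<in> g ` s.Fix"
        using x by (auto simp: fixed_points_def)
    qed
    have sub: "s.Fix \<subseteq> X"
      by (auto simp: fixed_points_def)
    have "inj_on g s.Fix"
      using bij sub by (meson bij_betw_def inj_on_subset)
    moreover have "locally_prefix_replacing g x" if "x \<in> s.Fix" for x
      using carrier_locally_prefix_replacing g(1) sub that by (auto simp: carrier_G)
    ultimately have "cylinder_count (g ` s.Fix) = cylinder_count s.Fix"
      using locally_prefix_replacing_image(2)[OF s.clopen_fixed] by blast
    then show "fixed_point_type \<sigma> = fixed_point_type \<tau>"
      unfolding fixed_point_type_def img[symmetric] by simp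
  }
  assume "fixed_point_type \<sigma> = fixed_point_type \<tau>"
  then have "cylinder_count s.Fix = cylinder_count t.Fix" "s.Fix = {} \<longleftrightarrow> t.Fix = {}"
    by (simp_all add: fixed_point_type_def)
  then obtain g where g: "bij_betw g X X" "\<And>x. x \<in> X \<Longrightarrow> locally_prefix_replacing g x"
    "\<And>x. x \<in> X \<Longrightarrow> g (\<sigma> x) = \<tau> (g x)"
    using prime_period_conjugator[OF s.prime_period_axioms t.prime_period_axioms p(2)]
      torsion_prime_period(2)[OF p(1)] \<sigma> \<tau> by metis
  have gG: "restrict g X \<in> carrier G"
    using g(1,2) by (rule restrict_in_carrier)
  moreover have "compose X (restrict g X) \<sigma> = compose X \<tau> (restrict g X)"
    using g(3) s.in_X by (auto simp: compose_def)
  ultimately show "conjugate G \<sigma> \<tau>"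
    unfolding conjugate_def using carrier mult_G by metis
qed

lemma card_fixed_point_types:
  assumes p: "prime p" "coprime p (N - 1)"
  shows "card (fixed_point_type ` torsion G p) = N"
proof -
  have realize: "\<exists>\<tau>\<in>torsion G p. fixed_point_type \<tau> = (f mod (N - 1), f = 0)" for f
  proof -
    obtain x where x: "[p * x = 1] (mod (N - 1))"
      using cong_solve_coprime_nat[OF p(2)] by auto
    obtain k where k: "N - 1 = k + 1"
      using N_gt_1 by (metis add.commute less_imp_Suc_add plus_1_eq_Suc zero_less_diff)
    \<comment> \<open>Here \<open>x\<close> inverts \<open>p\<close> and \<open>k\<close> is -1
      modulo \<open>N - 1\<close>, so \<open>r\<close> solves \<open>p * r = 1 - f\<close> there
      without subtraction. The summand \<open>N - 1\<close> makes \<open>r\<close> positive.\<close>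
    define r where "r = x * (1 + f * k) + (N - 1)"
    have "p * r + f = (p * x) * (1 + f * k) + f + p * (N - 1)"
      by (simp only: r_def algebra_simps)
    then have "[p * r + f = (p * x) * (1 + f * k) + f] (mod (N - 1))"
      by (simp only: cong_def mod_mult_self1)
    also have "[(p * x) * (1 + f * k) + f = 1 * (1 + f * k) + f] (mod (N - 1))"
      by (intro cong_add cong_mult x cong_refl)
    also have "1 * (1 + f * k) + f = 1 + f * (N - 1)"
      unfolding k by simp
    also have "[1 + f * (N - 1) = 1] (mod (N - 1))"
      unfolding cong_def by (rule mod_mult_self1)
    finally have "[p * r + f = 1] (mod (N - 1))" .
    moreover have "r > 0"
      using N_gt_1 by (simp add: r_def)
    ultimately obtain \<tau> where \<tau>: "prime_period N \<tau> p" "fixed_points X \<tau> \<noteq> X"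
      "cylinder_count (fixed_points X \<tau>) = f mod (N - 1)" "fixed_points X \<tau> = {} \<longleftrightarrow> f = 0"
      using prime_period_exists[OF p(1)] by metis
    have "fixed_points X (restrict \<tau> X) = fixed_points X \<tau>"
      by (auto simp: fixed_points_def)
    then have "fixed_point_type (restrict \<tau> X) = (f mod (N - 1), f = 0)"
      using \<tau>(3,4) by (simp add: fixed_point_type_def)
    then show ?thesis
      using prime_period_torsion[OF \<tau>(1,2)] by blast
  qed
  have "fixed_point_type ` torsion G p = insert (0, True) ((\<lambda>c. (c, False)) ` {..<N - 1})"
  proof (intro equalityI subsetI)
    fix t assume "t \<in> fixed_point_type ` torsion G p"
    then obtain \<tau> where t: "t = fixed_point_type \<tau>"
      by blast
    have "cylinder_count A < N - 1" for A
      using N_gt_1 by (simp add: cylinder_count_def)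
    \<comment> \<open>An empty fixed point set has count 0, so only one pair carries the flag
      \<open>True\<close>.\<close>
    then show "t \<in> insert (0, True) ((\<lambda>c. (c, False)) ` {..<N - 1})"
      unfolding t fixed_point_type_def using cylinder_count_empty
      by (cases "fixed_points X \<tau> = {}") simp_all
  next
    fix t :: "nat \<times> bool" assume "t \<in> insert (0, True) ((\<lambda>c. (c, False)) ` {..<N - 1})"
    then consider "t = (0, True)" | c where "c < N - 1" "t = (c, False)"
      by blast
    then obtain f where "t = (f mod (N - 1), f = 0)"
    proof cases
      case 1
      then show thesis
        using that[of 0] by simp
    next
      case (2 c)
      then have "(c + (N - 1)) mod (N - 1) = c"
        by (simp only: mod_add_self2 mod_less)
      then show thesis
        \<comment> \<open>Adding \<open>N - 1\<close> gives a nonzero representative even of the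
          residue 0, so that the fixed point set is nonempty.\<close>
        using that[of "c + (N - 1)"] 2 N_gt_1 by auto
    qed
    then show "t \<in> fixed_point_type ` torsion G p"
      using realize[of f] by (metis imageI)
  qed
  moreover have "card (insert (0, True) ((\<lambda>c. (c, False)) ` {..<N - 1})) = N"
    using N_gt_1 by (subst card_insert_disjoint) (auto simp: card_image inj_on_def)
  ultimately show ?thesis
    by simp
qed

end

section \<open>Recovering the alphabet size from the group\<close>

lemma coprime_of_large_prime:
  fixes p n :: nat
  assumes "prime p" "0 < n" "n < p"
  shows "coprime p n"
  using assms by (meson nat_dvd_not_less prime_imp_coprime)

theorem corollary1p5:
  fixes N M :: nat
  assumes "N > 1" and "M > 1"
  shows "continuous_full_group N \<cong> continuous_full_group M \<longleftrightarrow> N = M"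
proof
  assume "continuous_full_group N \<cong> continuous_full_group M"
  then obtain \<phi> where \<phi>: "\<phi> \<in> iso (continuous_full_group N) (continuous_full_group M)"
    unfolding is_iso_def by blast
  interpret n: full_shift N
    by standard (rule assms(1))
  interpret m: full_shift M
    by standard (rule assms(2))
  obtain p where p: "prime p" "p > N + M"
    using bigger_prime by blast
  have coprime: "coprime p (N - 1)" "coprime p (M - 1)"
    using p assms by (auto intro!: coprime_of_large_prime)
  note group = group_continuous_full_group
  have img: "\<phi> ` torsion n.G p = torsion m.G p"
    using iso_torsion[OF group group \<phi>] .
  \<comment> \<open>In each group the type classifies torsion elements up to conjugacy, and
    \<open>\<phi>\<close> preserves conjugacy. The two type functions therefore identify the same
    elements.\<close>
  have "card (n.fixed_point_type ` torsion n.G p) = card ((m.fixed_point_type \<circ> \<phi>) ` torsion n.G p)"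
  proof (rule card_image_eq_if_same_kernel)
    fix x y assume xy: "x \<in> torsion n.G p" "y \<in> torsion n.G p"
    then have "x \<in> carrier n.G" "y \<in> carrier n.G" "\<phi> x \<in> torsion m.G p" "\<phi> y \<in> torsion m.G p"
      using img by (auto simp: torsion_def)
    then show "n.fixed_point_type x = n.fixed_point_type y
        \<longleftrightarrow> (m.fixed_point_type \<circ> \<phi>) x = (m.fixed_point_type \<circ> \<phi>) y"
      using n.conjugate_iff_fixed_point_type[OF p(1) coprime(1) xy]
        m.conjugate_iff_fixed_point_type[OF p(1) coprime(2), of "\<phi> x" "\<phi> y"]
        iso_conjugate_iff[OF \<phi> group] by simp
  qed
  then show "N = M"
    using n.card_fixed_point_types[OF p(1) coprime(1)] m.card_fixed_point_types[OF p(1) coprime(2)]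
    by (simp only: image_comp[symmetric] img)
next
  assume "N = M"
  then show "continuous_full_group N \<cong> continuous_full_group M"
    by (simp add: iso_refl)
qed

end
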